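(* Let $n\ge 2$ be an integer and $\varepsilon>0$ a real number. There is a constant $C>0$ depending only on $n$ and $\varepsilon$ such that for every integer $k\ge1$, the probability that a matrix chosen uniformly at random from $\mathcal{M}_n(k)$ has at least one integer eigenvalue is at most $C/k^{1-\varepsilon}$. In particular, for every integer $k\ge 1$ the probability that a matrix chosen uniformly at random from $\mathcal{M}_n(k)$ is diagonalizable over $\mathbb{Q}$ is at most $C/k^{1-\varepsilon}$.
   Context: For an integer $k\ge1$, let $\mathcal{I}_k=\{-k,-k+1,\dots,k-1,k\}$, and let $\mathcal{M}_n(k)$ be the set of all $n\times n$ matrices all of whose entries lie in $\mathcal{I}_k$; it has $(2k+1)^{n^2}$ elements. "Chosen uniformly at random" means each matrix in $\mathcal{M}_n(k)$ has probability $(2k+1)^{-n^2}$, i.e. each entry is chosen independently and uniformly from $\mathcal{I}_k$. *)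

theory Defs
  imports
    "HOL-Probability.Probability"
    "Jordan_Normal_Form.Char_Poly"
begin

definition bounded_int_mats :: "nat \<Rightarrow> nat \<Rightarrow> int mat set" where
  "bounded_int_mats n k = {A \<in> carrier_mat n n. elements_mat A \<subseteq> {- int k..int k}}"

definition has_int_eigenvalue :: "int mat \<Rightarrow> bool" where
  "has_int_eigenvalue A \<longleftrightarrow> (\<exists>m :: int. eigenvalue (map_mat complex_of_int A) (complex_of_int m))"

definition diagonalizable_over_rat :: "int mat \<Rightarrow> bool" where
  "diagonalizable_over_rat A \<longleftrightarrow>
     (\<exists>D :: rat mat. diagonal_mat D \<and> similar_mat (map_mat rat_of_int A) D)"

text \<open>The facts below ensure that \<^const>\<open>pmf_of_set\<close>, which is unspecified for empty or infinite
  sets, is the intended uniform distribution on \<^const>\<open>bounded_int_mats\<close>.\<close>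

lemma bij_betw_bounded_int_mats:
  "bij_betw (mat n n) (({..<n} \<times> {..<n}) \<rightarrow>\<^sub>E {- int k..int k}) (bounded_int_mats n k)"
proof (rule bij_betwI[where g = "\<lambda>A. restrict (\<lambda>ij. A $$ ij) ({..<n} \<times> {..<n})"])
  show "mat n n \<in> (({..<n} \<times> {..<n}) \<rightarrow>\<^sub>E {- int k..int k}) \<rightarrow> bounded_int_mats n k"
  proof
    fix f assume f: "f \<in> ({..<n} \<times> {..<n}) \<rightarrow>\<^sub>E {- int k..int k}"
    have "elements_mat (mat n n f) \<subseteq> {- int k..int k}"
    proof
      fix a assume "a \<in> elements_mat (mat n n f)"
      then obtain i j where "i < n" "j < n" "a = f (i, j)"
        by (auto dest!: elements_matD)
      then show "a \<in> {- int k..int k}"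
        using PiE_mem[OF f, of "(i, j)"] by simp
    qed
    then show "mat n n f \<in> bounded_int_mats n k"
      by (simp add: bounded_int_mats_def)
  qed
next
  show "(\<lambda>A. restrict (\<lambda>ij. A $$ ij) ({..<n} \<times> {..<n}))
      \<in> bounded_int_mats n k \<rightarrow> (({..<n} \<times> {..<n}) \<rightarrow>\<^sub>E {- int k..int k})"
    unfolding bounded_int_mats_def by (intro Pi_I restrict_PiE_iff[THEN iffD2]) (use elements_matI in blast)
next
  fix f assume "f \<in> ({..<n} \<times> {..<n}) \<rightarrow>\<^sub>E {- int k..int k}"
  then show "restrict (\<lambda>ij. mat n n f $$ ij) ({..<n} \<times> {..<n}) = f"
    by (intro extensionalityI[of _ "{..<n} \<times> {..<n}"]) (auto simp: PiE_def)
next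
  fix A assume "A \<in> bounded_int_mats n k"
  then show "mat n n (restrict (\<lambda>ij. A $$ ij) ({..<n} \<times> {..<n})) = A"
    by (intro eq_matI) (auto simp: bounded_int_mats_def)
qed

lemma finite_bounded_int_mats: "finite (bounded_int_mats n k)"
  using bij_betw_finite[OF bij_betw_bounded_int_mats[of n k]]
  by (simp add: finite_PiE)

lemma card_bounded_int_mats: "card (bounded_int_mats n k) = (2 * k + 1) ^ (n\<^sup>2)"
proof -
  have "card (bounded_int_mats n k) = card (({..<n} \<times> {..<n}) \<rightarrow>\<^sub>E {- int k..int k})"
    using bij_betw_same_card[OF bij_betw_bounded_int_mats[of n k]] by simp
  also have "\<dots> = (2 * k + 1) ^ (n\<^sup>2)"
    by (simp add: card_PiE power2_eq_square nat_add_distrib nat_mult_distrib)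
  finally show ?thesis .
qed

lemma bounded_int_mats_nonempty: "bounded_int_mats n k \<noteq> {}"
  using card_bounded_int_mats[of n k] by (metis add_gr_0 card.empty less_numeral_extra(1,3) zero_less_power)

lemma pmf_uniform_bounded_int_mats:
  assumes "A \<in> bounded_int_mats n k"
  shows "pmf (pmf_of_set (bounded_int_mats n k)) A = 1 / real ((2 * k + 1) ^ (n\<^sup>2))"
  using assms by (simp add: pmf_of_set finite_bounded_int_mats bounded_int_mats_nonempty
      card_bounded_int_mats)

end

theory Submission
  imports Defs
begin

text \<open>
  An integer eigenvalue \<open>l\<close> of \<open>A\<close> satisfies \<open>\<bar>l\<bar> \<le> nk\<close>, so it suffices to show that for each
  such \<open>l\<close> the matrix \<open>B = A - l\<close> is singular with probability \<open>O(k\<^bsup>\<epsilon>-2\<^esup>)\<close>.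
  If \<open>det B = 0\<close>, then all \<open>2 \<times> 2\<close> minors of the adjugate vanish, so
  \<open>cofactor B 0 1 * cofactor B 1 0 = cofactor B 0 0 * cofactor B 1 1\<close>.
  The right-hand side \<open>m\<close> involves neither \<open>x = B $$ (0, 1)\<close> nor \<open>y = B $$ (1, 0)\<close>, while the factors
  on the left are affine in \<open>y\<close> and in \<open>x\<close> respectively, with slope \<open>\<plusminus>\<alpha>\<close>, where \<open>\<alpha>\<close> is
  the minor of \<open>B\<close> without its first two rows and columns.
  If \<open>\<alpha> \<noteq> 0\<close> and \<open>m \<noteq> 0\<close>, the pair \<open>(x, y)\<close> is determined by a divisor of \<open>m\<close>, which leaves
  \<open>O(k\<^bsup>\<epsilon>\<^esup>)\<close> of the \<open>k\<^sup>2\<close> choices.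
  If \<open>\<alpha> = 0\<close> and \<open>m \<noteq> 0\<close>, then \<open>\<alpha> = 0\<close> costs a factor \<open>k\<close>, and \<open>det B = 0\<close> determines \<open>x\<close> from
  the other entries, which costs another.
  If \<open>m = 0\<close>, a principal minor of size \<open>n - 1\<close> vanishes and induction on \<open>n\<close> applies; for \<open>n = 2\<close>,
  both a diagonal and an off-diagonal entry vanish.
  The shift by \<open>l\<close> is absorbed by letting each entry of \<open>B\<close> range over its own set of at most \<open>N\<close>
  integers of absolute value at most \<open>M\<close>.
\<close>

section \<open>The divisor bound\<close>

text \<open>A divisor of a product splits into divisors of the two factors, and those of
  \<open>p ^ a\<close> are the \<open>a + 1\<close> powers \<open>p ^ i\<close> with
  \<open>i \<le> a\<close>.\<close>

lemma card_divisors_prime_power_mult_le: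
  fixes p m :: nat
  assumes "prime p" "m > 0"
  shows "card {d. d dvd p ^ a * m} \<le> (a + 1) * card {d. d dvd m}"
proof -
  have "{d. d dvd p ^ a * m} \<subseteq> (\<lambda>(i, d). p ^ i * d) ` ({..a} \<times> {d. d dvd m})"
  proof
    fix d assume "d \<in> {d. d dvd p ^ a * m}"
    then obtain b c where bc: "d = b * c" "b dvd p ^ a" "c dvd m"
      using division_decomp by blast
    then obtain i where "i \<le> a" "b = p ^ i"
      using divides_primepow_nat[OF assms(1)] by blast
    then show "d \<in> (\<lambda>(i, d). p ^ i * d) ` ({..a} \<times> {d. d dvd m})"
      using bc by (auto intro!: image_eqI[of _ _ "(i, c)"])
  qed
  then have "card {d. d dvd p ^ a * m} \<le> card ({..a} \<times> {d. d dvd m})"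
    using assms(2) by (intro surj_card_le) auto
  then show ?thesis by (simp add: card_cartesian_product)
qed

text \<open>The divisor count is compared with \<open>m powr \<epsilon>\<close> one prime power at a
  time. A prime with \<open>p powr \<epsilon> \<ge> 2\<close> costs nothing, since
  \<open>a + 1 \<le> 2 ^ a\<close>; each of the fewer than \<open>P\<close> possible smaller primes
  costs a factor \<open>K\<close>, whence the constant \<open>K ^ P\<close>.\<close>

lemma card_nat_divisors_le_powr:
  fixes \<epsilon> :: real
  assumes "\<epsilon> > 0"
  shows "\<exists>C \<ge> 1. \<forall>m > 0. real (card {d::nat. d dvd m}) \<le> C * real m powr \<epsilon>"
proof -
  define P where "P = nat \<lceil>2 powr (1 / \<epsilon>)\<rceil>"
  \<comment> \<open>With \<open>l = \<epsilon> * ln 2\<close>, this choice gives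
    \<open>a + 1 \<le> K * (1 + l * a)\<close>, and \<open>1 + l * a \<le> exp (l * a)\<close>,
    which equals \<open>(2 ^ a) powr \<epsilon>\<close>.\<close>
  define K where "K = 1 + 1 / (\<epsilon> * ln 2)"
  define small where "small m = {p. prime p \<and> p dvd m \<and> p < P}" for m :: nat
  have K: "K \<ge> 1" using assms by (simp add: K_def)
  have fin: "finite (small m)" for m
    by (rule finite_subset[of _ "{..<P}"]) (auto simp: small_def)
  have large: "real a + 1 \<le> real (p ^ a) powr \<epsilon>" if "p \<ge> P" "prime p" for p a
  proof -
    have p: "real p > 0" using that(2) prime_gt_0_nat by simp
    have "2 = (2 powr (1 / \<epsilon>)) powr \<epsilon>" using assms by (simp add: powr_powr)
    also have "\<dots> \<le> real p powr \<epsilon>"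
      using that(1) assms by (intro powr_mono2) (auto simp: P_def nat_ceiling_le_eq)
    finally have "2 ^ a \<le> (real p powr \<epsilon>) ^ a" by (intro power_mono) auto
    also have "\<dots> = real (p ^ a) powr \<epsilon>"
      using p by (simp add: powr_realpow[symmetric] powr_powr mult.commute)
    finally have "2 ^ a \<le> real (p ^ a) powr \<epsilon>" .
    moreover have "real a + 1 \<le> 2 ^ a"
      using less_exp[of a] by (metis Suc_eq_plus1 Suc_leI of_nat_1 of_nat_add of_nat_le_iff
          of_nat_numeral of_nat_power)
    ultimately show ?thesis by linarith
  qed
  have any: "real a + 1 \<le> K * real (p ^ a) powr \<epsilon>" if "prime p" for p a
  proof -
    have p: "p \<ge> 2" using that prime_ge_2_nat by simp
    have l: "\<epsilon> * ln 2 > 0" using assms by simp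
    have "(1 + 1 / l) * (1 + l * a) = real a + 1 + (1 / l + l * a)" if "l > 0" for l :: real
      using that by (simp add: field_simps)
    from this[OF l] have "real a + 1 \<le> K * (1 + \<epsilon> * ln 2 * a)"
      using l unfolding K_def by simp
    also have "1 + \<epsilon> * ln 2 * a \<le> exp (\<epsilon> * ln 2 * a)" by (rule exp_ge_add_one_self)
    also have "\<dots> = real (2 ^ a) powr \<epsilon>"
      by (simp add: powr_def ln_realpow mult_ac)
    also have "\<dots> \<le> real (p ^ a) powr \<epsilon>"
      using assms p by (intro powr_mono2) (auto intro: power_mono)
    finally show ?thesis using K by (simp add: mult_left_mono)
  qed
  \<comment> \<open>The induction strips the full power of one prime \<open>p\<close> from
    \<open>m\<close>. If \<open>p < P\<close>, then \<open>p\<close> leaves the set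
    \<open>small\<close>, which pays for the factor \<open>K\<close>.\<close>
  have main: "real (card {d. d dvd m}) \<le> K ^ card (small m) * real m powr \<epsilon>" if "m > 0" for m
    using that
  proof (induction m rule: less_induct)
    case (less m)
    show ?case
    proof (cases "m = 1")
      case True
      then have "small m = {}" by (auto simp: small_def)
      with True show ?thesis by simp
    next
      case False
      then obtain p where p: "prime p" "p dvd m" using prime_factor_nat by blast
      define a where "a = multiplicity p m"
      have "\<not> is_unit p" using p by auto
      then obtain m' where m': "m = p ^ a * m'" "\<not> p dvd m'"
        using multiplicity_decompose'[of m p] less.prems unfolding a_def by auto
      have "a > 0" using p less.prems by (auto simp: a_def prime_multiplicity_gt_zero_iff)
      then have pa: "p ^ a > 1" using p prime_gt_1_nat one_less_power by blast
      have pos: "m' > 0" using less.prems m' by (cases m') auto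
      have lt: "m' < m" using pa pos m' by simp
      have bound: "real (card {d. d dvd m}) \<le> (real a + 1) * (K ^ card (small m') * real m' powr \<epsilon>)"
      proof -
        have "real (card {d. d dvd m}) \<le> real ((a + 1) * card {d. d dvd m'})"
          using card_divisors_prime_power_mult_le[OF p(1) pos, of a] m' by (simp only: of_nat_le_iff)
        also have "\<dots> = (real a + 1) * card {d. d dvd m'}" by (simp add: algebra_simps)
        also have "\<dots> \<le> (real a + 1) * (K ^ card (small m') * real m' powr \<epsilon>)"
          by (intro mult_left_mono less.IH[OF lt pos]) auto
        finally show ?thesis .
      qed
      have mm: "real m powr \<epsilon> = real (p ^ a) powr \<epsilon> * real m' powr \<epsilon>"
        by (simp add: m'(1) powr_mult)
      have sub: "small m' \<subseteq> small m" using m' by (auto simp: small_def)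
      have "(real a + 1) * K ^ card (small m') \<le> K ^ card (small m) * real (p ^ a) powr \<epsilon>"
      proof (cases "p < P")
        case True
        then have "insert p (small m') \<subseteq> small m" using p sub by (auto simp: small_def)
        moreover have "p \<notin> small m'" using m' by (auto simp: small_def)
        ultimately have "Suc (card (small m')) \<le> card (small m)"
          using fin by (metis card_insert_disjoint card_mono)
        then have "K ^ Suc (card (small m')) \<le> K ^ card (small m)"
          using K by (intro power_increasing) auto
        moreover have "(real a + 1) * K ^ card (small m') \<le> K * real (p ^ a) powr \<epsilon> * K ^ card (small m')"
          using any[OF p(1), of a] K by (intro mult_right_mono) auto
        moreover have "\<dots> = K ^ Suc (card (small m')) * real (p ^ a) powr \<epsilon>" by simp
        ultimately show ?thesis
          by (smt (verit) mult_right_mono powr_ge_zero)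
      next
        case False
        have "K ^ card (small m') \<le> K ^ card (small m)"
          using K sub fin by (intro power_increasing card_mono) auto
        with large[of p a] False p(1) K show ?thesis
          by (subst mult.commute[of "K ^ card (small m)"]) (intro mult_mono, auto)
      qed
      then have "(real a + 1) * K ^ card (small m') * real m' powr \<epsilon>
          \<le> K ^ card (small m) * real (p ^ a) powr \<epsilon> * real m' powr \<epsilon>"
        by (intro mult_right_mono) auto
      with bound mm show ?thesis by (simp add: mult_ac)
    qed
  qed
  show ?thesis
  proof (intro exI[of _ "K ^ P"] conjI allI impI)
    show "K ^ P \<ge> 1" using K by simp
    fix m :: nat assume "m > 0"
    have "card (small m) \<le> card {..<P}" by (intro card_mono) (auto simp: small_def)
    then have "K ^ card (small m) \<le> K ^ P" using K by (intro power_increasing) auto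
    then show "real (card {d. d dvd m}) \<le> K ^ P * real m powr \<epsilon>"
      using main[OF \<open>m > 0\<close>] by (smt (verit) mult_right_mono powr_ge_zero)
  qed
qed

text \<open>Each natural divisor occurs with both signs, so the constant doubles.\<close>

lemma card_int_divisors_le_powr:
  fixes \<epsilon> :: real
  assumes "\<epsilon> > 0"
  shows "\<exists>C \<ge> 1. \<forall>m \<noteq> 0. real (card {d::int. d dvd m}) \<le> C * real_of_int \<bar>m\<bar> powr \<epsilon>"
proof -
  obtain C where C: "C \<ge> 1" "\<And>m. m > 0 \<Longrightarrow> real (card {d::nat. d dvd m}) \<le> C * real m powr \<epsilon>"
    using card_nat_divisors_le_powr[OF assms] by blast
  have "real (card {d::int. d dvd m}) \<le> 2 * C * real_of_int \<bar>m\<bar> powr \<epsilon>" if "m \<noteq> 0" for m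
  proof -
    let ?D = "{d::nat. d dvd nat \<bar>m\<bar>}"
    have fin: "finite ?D" using that by (intro finite_divisors_nat) simp
    have "d \<in> int ` ?D \<union> (\<lambda>d. - int d) ` ?D" if "d dvd m" for d
    proof (cases "d \<ge> 0")
      case True
      then have "d = int (nat \<bar>d\<bar>)" by simp
      then show ?thesis using that by (metis (mono_tags) UnI1 imageI mem_Collect_eq nat_abs_dvd_iff abs_dvd_iff dvd_abs_iff int_nat_eq int_dvd_int_iff abs_ge_zero nat_0_le)
    next
      case False
      then have "d = - int (nat \<bar>d\<bar>)" by simp
      then show ?thesis using that by (metis (mono_tags, lifting) UnI2 imageI mem_Collect_eq abs_dvd_iff dvd_abs_iff int_dvd_int_iff abs_ge_zero nat_0_le)
    qed
    then have "card {d::int. d dvd m} \<le> card (int ` ?D \<union> (\<lambda>d. - int d) ` ?D)"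
      using fin by (intro card_mono) auto
    also have "\<dots> \<le> card ?D + card ?D"
      by (intro order.trans[OF card_Un_le] add_mono card_image_le fin)
    finally have "real (card {d::int. d dvd m}) \<le> 2 * real (card ?D)" by simp
    also have "\<dots> \<le> 2 * (C * real (nat \<bar>m\<bar>) powr \<epsilon>)"
      using that by (intro mult_left_mono C) auto
    finally show ?thesis by simp
  qed
  with C(1) show ?thesis by (intro exI[of _ "2 * C"]) auto
qed

section \<open>Determinants and cofactors\<close>

definition replace_column :: "'a mat \<Rightarrow> nat \<Rightarrow> (nat \<Rightarrow> 'a) \<Rightarrow> 'a mat" where
  "replace_column A j v = mat (dim_row A) (dim_col A) (\<lambda>(a, b). if b = j then v a else A $$ (a, b))"

text \<open>Both determinants are expanded along row \<open>i\<close>. The cofactors of that row do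
  not see the changed entry, so they coincide, and only the column \<open>j\<close> term survives in
  the difference.\<close>

lemma det_diff_single_entry:
  fixes A B :: "'a :: comm_ring_1 mat"
  assumes A: "A \<in> carrier_mat n n" and B: "B \<in> carrier_mat n n" and ij: "i < n" "j < n"
    and eq: "\<And>a b. a < n \<Longrightarrow> b < n \<Longrightarrow> (a, b) \<noteq> (i, j) \<Longrightarrow> A $$ (a, b) = B $$ (a, b)"
  shows "det A - det B = (A $$ (i, j) - B $$ (i, j)) * cofactor A i j"
proof -
  have cof: "cofactor B i b = cofactor A i b" if "b < n" for b
  proof -
    have "mat_delete B i b = mat_delete A i b"
      using A B eq that by (intro eq_matI) (auto simp: mat_delete_def)
    then show ?thesis by (simp add: cofactor_def)
  qed
  have "det A - det B = (\<Sum>b<n. (A $$ (i, b) - B $$ (i, b)) * cofactor A i b)"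
    using cof by (simp add: laplace_expansion_row[OF A ij(1)] laplace_expansion_row[OF B ij(1)]
        sum_subtractf left_diff_distrib)
  also have "\<dots> = (\<Sum>b<n. if b = j then (A $$ (i, j) - B $$ (i, j)) * cofactor A i j else 0)"
    using eq ij by (intro sum.cong) auto
  also have "\<dots> = (A $$ (i, j) - B $$ (i, j)) * cofactor A i j"
    using ij by simp
  finally show ?thesis .
qed

text \<open>Expansion along column \<open>j\<close> has a single nonzero term. This presents a
  cofactor of \<open>B\<close> as a determinant to which the adjugate and Laplace identities
  apply.\<close>

lemma det_replace_column_unit:
  fixes B :: "'a :: comm_ring_1 mat"
  assumes B: "B \<in> carrier_mat n n" and ij: "i < n" "j < n"
  shows "det (replace_column B j (\<lambda>a. if a = i then 1 else 0)) = cofactor B i j"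
proof -
  let ?E = "replace_column B j (\<lambda>a. if a = i then 1 else 0)"
  have E: "?E \<in> carrier_mat n n" using B by (simp add: replace_column_def)
  have "mat_delete ?E i j = mat_delete B i j"
    using B ij by (intro eq_matI) (auto simp: mat_delete_def replace_column_def)
  then have cof: "cofactor ?E i j = cofactor B i j" by (simp add: cofactor_def)
  have "det ?E = (\<Sum>a<n. if a = i then cofactor ?E i j else 0)"
    unfolding laplace_expansion_column[OF E ij(2)]
    using B ij by (intro sum.cong) (auto simp: replace_column_def)
  then show ?thesis using ij cof by simp
qed

text \<open>Column 0 of the adjugate is annihilated by \<open>B\<close>. It is paired with a row
  vector \<open>\<kappa>\<close> such that \<open>\<kappa> B\<close> is supported in columns 0 and
  1, where its entries are the other two cofactors up to sign.\<close>

lemma cofactor_minor_singular: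
  fixes B :: "'a :: comm_ring_1 mat"
  assumes B: "B \<in> carrier_mat n n" and n: "n \<ge> 2" and sing: "det B = 0"
  shows "cofactor B 0 0 * cofactor B 1 1 = cofactor B 0 1 * cofactor B 1 0"
proof -
  define e :: "nat \<Rightarrow> 'a" where "e a = (if a = 1 then 1 else 0)" for a
  define E where "E = replace_column B 1 e"
  define G where "G = replace_column B 0 e"
  define \<kappa> where "\<kappa> i = cofactor E i 0" for i
  have E: "E \<in> carrier_mat n n" and G: "G \<in> carrier_mat n n"
    using B by (simp_all add: E_def G_def replace_column_def)
  have detE: "det E = cofactor B 1 1" and detG: "det G = cofactor B 1 0"
    using det_replace_column_unit[OF B, of 1 1] det_replace_column_unit[OF B, of 1 0] n
    by (simp_all add: E_def G_def e_def[abs_def])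
  \<comment> \<open>\<open>\<kappa>\<close> is row 0 of the adjugate of \<open>E\<close>, so
    \<open>\<kappa> E = (det E, 0, ..., 0)\<close>; this carries over to \<open>B\<close> except in
    column 1, where \<open>E\<close> was altered.\<close>
  have \<kappa>E: "(\<Sum>i<n. \<kappa> i * E $$ (i, j)) = (if j = 0 then det E else 0)" if "j < n" for j
  proof -
    have "(adj_mat E * E) $$ (0, j) = (\<Sum>i<n. \<kappa> i * E $$ (i, j))"
      using E n that by (auto simp: adj_mat_def scalar_prod_def \<kappa>_def atLeast0LessThan intro!: sum.cong)
    then show ?thesis using adj_mat(3)[OF E] n that by auto
  qed
  have \<kappa>1: "(\<Sum>i<n. \<kappa> i * B $$ (i, 1)) = - cofactor B 1 0"
  proof -
    \<comment> \<open>\<open>G\<close> without column 1 and \<open>E\<close> without column 0 are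
      the same matrix; the sign comes from the column index moving by one.\<close>
    have "cofactor G i 1 = - \<kappa> i" if "i < n" for i
    proof -
      have "mat_delete G i 1 = mat_delete E i 0"
        using B that n by (intro eq_matI) (auto simp: mat_delete_def E_def G_def replace_column_def)
      then show ?thesis by (simp add: \<kappa>_def cofactor_def)
    qed
    moreover have "G $$ (i, 1) = B $$ (i, 1)" if "i < n" for i
      using that B n by (simp add: G_def replace_column_def)
    ultimately have "det G = (\<Sum>i<n. B $$ (i, 1) * - \<kappa> i)"
      using laplace_expansion_column[OF G, of 1] n by simp
    then show ?thesis using detG by (simp add: sum_negf mult.commute)
  qed
  have \<kappa>B: "(\<Sum>i<n. \<kappa> i * B $$ (i, j)) =
      (if j = 0 then cofactor B 1 1 else if j = 1 then - cofactor B 1 0 else 0)" if "j < n" for j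
  proof (cases "j = 1")
    case False
    then have "(\<Sum>i<n. \<kappa> i * B $$ (i, j)) = (\<Sum>i<n. \<kappa> i * E $$ (i, j))"
      using that B by (intro sum.cong) (auto simp: E_def replace_column_def)
    then show ?thesis using \<kappa>E[OF that] False detE by simp
  qed (use \<kappa>1 in simp)
  have adj: "(\<Sum>j<n. B $$ (i, j) * cofactor B 0 j) = 0" if "i < n" for i
  proof -
    have "(B * adj_mat B) $$ (i, 0) = (\<Sum>j<n. B $$ (i, j) * cofactor B 0 j)"
      using B n that by (auto simp: adj_mat_def scalar_prod_def atLeast0LessThan intro!: sum.cong)
    then show ?thesis using adj_mat(2)[OF B] sing n that by simp
  qed
  \<comment> \<open>The product of \<open>\<kappa>\<close>, \<open>B\<close> and column 0 of the
    adjugate is evaluated in both ways of bracketing.\<close>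
  have "0 = (\<Sum>i<n. \<kappa> i * (\<Sum>j<n. B $$ (i, j) * cofactor B 0 j))"
    using adj by simp
  also have "\<dots> = (\<Sum>j<n. (\<Sum>i<n. \<kappa> i * B $$ (i, j)) * cofactor B 0 j)"
    unfolding sum_distrib_left sum_distrib_right by (subst sum.swap) (simp add: mult_ac)
  also have "\<dots> = (\<Sum>j<n. (if j = 0 then cofactor B 1 1 * cofactor B 0 0 else 0)
      + (if j = 1 then - cofactor B 1 0 * cofactor B 0 1 else 0))"
    using \<kappa>B by (intro sum.cong) auto
  also have "\<dots> = cofactor B 1 1 * cofactor B 0 0 - cofactor B 1 0 * cofactor B 0 1"
    unfolding sum.distrib using n by simp
  finally show ?thesis by (simp add: algebra_simps)
qed

text \<open>A crude Laplace estimate is enough: any polynomial bound in \<open>M\<close> can be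
  absorbed by shrinking the exponent in the divisor bound.\<close>

lemma abs_det_le:
  fixes B :: "int mat"
  assumes "B \<in> carrier_mat n n" "\<And>i j. i < n \<Longrightarrow> j < n \<Longrightarrow> \<bar>B $$ (i, j)\<bar> \<le> M" "M \<ge> 0"
  shows "\<bar>det B\<bar> \<le> fact n * M ^ n"
  using assms
proof (induction n arbitrary: B)
  case (Suc n)
  have "\<bar>det B\<bar> \<le> (\<Sum>j<Suc n. \<bar>B $$ (0, j)\<bar> * \<bar>cofactor B 0 j\<bar>)"
    unfolding laplace_expansion_row[OF Suc.prems(1) zero_less_Suc] abs_mult[symmetric] by (rule sum_abs)
  also have "\<dots> \<le> (\<Sum>j<Suc n. M * (fact n * M ^ n))"
  proof (intro sum_mono mult_mono)
    fix j assume j: "j \<in> {..<Suc n}"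
    show "\<bar>B $$ (0, j)\<bar> \<le> M" using Suc.prems(2)[of 0 j] j by simp
    have "\<bar>det (mat_delete B 0 j)\<bar> \<le> fact n * M ^ n"
    proof (rule Suc.IH)
      show "mat_delete B 0 j \<in> carrier_mat n n" using mat_delete_carrier[OF Suc.prems(1)] by simp
      show "\<bar>mat_delete B 0 j $$ (a, b)\<bar> \<le> M" if "a < n" "b < n" for a b
        using Suc.prems(1,2) that by (auto simp: mat_delete_def)
    qed (rule Suc.prems(3))
    then show "\<bar>cofactor B 0 j\<bar> \<le> fact n * M ^ n" by (simp add: cofactor_def abs_mult power_abs)
  qed (use Suc.prems in auto)
  also have "\<dots> = fact (Suc n) * M ^ Suc n" by (simp add: algebra_simps)
  finally show ?case .
qed simp

section \<open>Counting singular matrices\<close>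

text \<open>Each position has its own set, because a shift by \<open>l\<close> moves only the
  diagonal ranges and because deleting a row and a column must stay within the same kind of
  class.\<close>

definition mats_over :: "nat \<Rightarrow> (nat \<Rightarrow> nat \<Rightarrow> int set) \<Rightarrow> int mat set" where
  "mats_over n I = {B \<in> carrier_mat n n. \<forall>i<n. \<forall>j<n. B $$ (i, j) \<in> I i j}"

definition singular_mats :: "nat \<Rightarrow> (nat \<Rightarrow> nat \<Rightarrow> int set) \<Rightarrow> int mat set" where
  "singular_mats n I = {B \<in> mats_over n I. det B = 0}"

definition agree_off :: "nat \<Rightarrow> (nat \<times> nat) set \<Rightarrow> 'a mat \<Rightarrow> 'a mat \<Rightarrow> bool" where
  "agree_off n K A B \<longleftrightarrow> (\<forall>a<n. \<forall>b<n. (a, b) \<notin> K \<longrightarrow> A $$ (a, b) = B $$ (a, b))"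

text \<open>These are the sets of the positions that survive in \<open>mat_delete B i i\<close>; the
  inductions pass to principal minors only.\<close>

definition delete_family :: "(nat \<Rightarrow> nat \<Rightarrow> 'a) \<Rightarrow> nat \<Rightarrow> nat \<Rightarrow> nat \<Rightarrow> 'a" where
  "delete_family I i = (\<lambda>a b. I (insert_index i a) (insert_index i b))"

section \<open>Counting by fibres over prescribed entries\<close>

lemma finite_mats_over:
  assumes "\<And>i j. finite (I i j)"
  shows "finite (mats_over n I)"
proof (rule finite_subset)
  show "mats_over n I \<subseteq> mat n n ` (({..<n} \<times> {..<n}) \<rightarrow>\<^sub>E (\<Union>i<n. \<Union>j<n. I i j))"
  proof
    fix B assume B: "B \<in> mats_over n I"
    let ?f = "restrict (\<lambda>ij. B $$ ij) ({..<n} \<times> {..<n})"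
    have "B = mat n n ?f" using B by (intro eq_matI) (auto simp: mats_over_def)
    moreover have "?f \<in> ({..<n} \<times> {..<n}) \<rightarrow>\<^sub>E (\<Union>i<n. \<Union>j<n. I i j)"
      using B by (auto simp: mats_over_def)
    ultimately show "B \<in> mat n n ` (({..<n} \<times> {..<n}) \<rightarrow>\<^sub>E (\<Union>i<n. \<Union>j<n. I i j))"
      by (rule image_eqI)
  qed
  show "finite (mat n n ` (({..<n} \<times> {..<n}) \<rightarrow>\<^sub>E (\<Union>i<n. \<Union>j<n. I i j)))"
    using assms by (intro finite_imageI finite_PiE) auto
qed

text \<open>Grouping \<open>T\<close> by the entries outside \<open>K\<close> gives at most
  \<open>N ^ (n\<^sup>2 - card K)\<close> groups, each with at most \<open>D\<close> members. The
  factor \<open>N ^ card K\<close> on the left replaces that subtraction in the exponent.\<close>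

lemma card_le_fibers:
  fixes D :: real
  assumes fin: "\<And>i j. finite (I i j)" and card: "\<And>i j. card (I i j) \<le> N"
    and T: "T \<subseteq> mats_over n I" and K: "K \<subseteq> {..<n} \<times> {..<n}" and D: "D \<ge> 0"
    and fiber: "\<And>A. A \<in> T \<Longrightarrow> real (card {B \<in> T. agree_off n K A B}) \<le> D"
  shows "real (card T) * real N ^ card K \<le> D * real N ^ n\<^sup>2"
proof -
  let ?Q = "{..<n} \<times> {..<n}"
  define J where "J = ?Q - K"
  define F where "F f = {B \<in> T. restrict (\<lambda>ij. B $$ ij) J = f}" for f
  let ?P = "PiE J (\<lambda>(i, j). I i j)"
  have finT: "finite T" using T finite_mats_over[OF fin] by (rule finite_subset)
  have finJ: "finite J" by (simp add: J_def)
  have F: "real (card (F f)) \<le> D" for f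
  proof (cases "F f = {}")
    case False
    then obtain A where A: "A \<in> F f" by blast
    have "F f \<subseteq> {B \<in> T. agree_off n K A B}"
    proof
      fix B assume B: "B \<in> F f"
      have "A $$ (a, b) = B $$ (a, b)" if "a < n" "b < n" "(a, b) \<notin> K" for a b
      proof -
        have "restrict (\<lambda>ij. A $$ ij) J (a, b) = restrict (\<lambda>ij. B $$ ij) J (a, b)"
          using A B by (simp add: F_def)
        then show ?thesis using that by (simp add: J_def)
      qed
      with B show "B \<in> {B \<in> T. agree_off n K A B}" by (simp add: F_def agree_off_def)
    qed
    then have "card (F f) \<le> card {B \<in> T. agree_off n K A B}"
      using finT by (intro card_mono) auto
    moreover have "A \<in> T" using A by (simp add: F_def)
    ultimately show ?thesis using fiber[of A] by linarith
  qed (use D in simp)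
  have "T \<subseteq> (\<Union>f\<in>?P. F f)"
  proof
    fix B assume "B \<in> T"
    with T have "restrict (\<lambda>ij. B $$ ij) J \<in> ?P" by (auto simp: mats_over_def J_def)
    with \<open>B \<in> T\<close> show "B \<in> (\<Union>f\<in>?P. F f)" by (auto simp: F_def)
  qed
  moreover have finP: "finite ?P" using finJ fin by (intro finite_PiE) auto
  moreover have "finite (F f)" for f using finT by (simp add: F_def)
  ultimately have "card T \<le> card (\<Union>f\<in>?P. F f)" by (intro card_mono) auto
  also have "\<dots> \<le> (\<Sum>f\<in>?P. card (F f))" by (rule card_UN_le[OF finP])
  finally have "real (card T) \<le> (\<Sum>f\<in>?P. real (card (F f)))"
    unfolding of_nat_sum[symmetric] of_nat_le_iff .
  also have "\<dots> \<le> real (card ?P) * D"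
    using F by (intro sum_bounded_above) auto
  also have "\<dots> \<le> real (N ^ card J) * D"
  proof -
    have "card ?P = (\<Prod>(i, j)\<in>J. card (I i j))"
      using finJ by (simp add: card_PiE case_prod_unfold)
    also have "\<dots> \<le> (\<Prod>_\<in>J. N)" using card by (intro prod_mono) auto
    finally show ?thesis using D by (intro mult_right_mono) auto
  qed
  finally have "real (card T) * real N ^ card K \<le> real (N ^ card J) * D * real N ^ card K"
    by (intro mult_right_mono) auto
  also have "\<dots> = D * real N ^ (card J + card K)" by (simp add: power_add mult_ac)
  also have "card J + card K = n\<^sup>2"
    using card_Diff_subset[OF finite_subset[OF K] K] card_mono[OF _ K]
    by (simp add: J_def power2_eq_square)
  finally show ?thesis .
qed

lemma mat_delete_eq_imp_entry_eq:
  assumes A: "A \<in> carrier_mat n n" and B: "B \<in> carrier_mat n n"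
    and eq: "mat_delete A i j = mat_delete B i j"
    and ij: "i < n" "j < n" and ab: "a < n" "b < n" "a \<noteq> i" "b \<noteq> j"
  shows "A $$ (a, b) = B $$ (a, b)"
proof -
  obtain l where l: "n = Suc l" using ij(1) by (cases n) auto
  let ?a = "delete_index i a" and ?b = "delete_index j b"
  have "?a < l" "?b < l" using ab ij l by (auto simp: delete_index_def)
  then have "A $$ (insert_index i ?a, insert_index j ?b) = B $$ (insert_index i ?a, insert_index j ?b)"
    using A B ij eq unfolding l by (simp add: mat_delete_index)
  then show ?thesis using ab by (simp add: insert_delete_index)
qed

lemma mat_delete_cong_agree_off:
  assumes A: "A \<in> carrier_mat n n" and B: "B \<in> carrier_mat n n" and "agree_off n K A B"
    and "\<And>a b. (a, b) \<in> K \<Longrightarrow> a = i \<or> b = j"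
  shows "mat_delete A i j = mat_delete B i j"
proof (rule eq_matI)
  fix a b assume "a < dim_row (mat_delete B i j)" "b < dim_col (mat_delete B i j)"
  then have ab: "a < n - 1" "b < n - 1" using B by auto
  let ?a = "insert_index i a" and ?b = "insert_index j b"
  have "?a < n" "?b < n" "(?a, ?b) \<notin> K"
    using ab assms(4)[of ?a ?b] by (auto simp: insert_index_def)
  then have "A $$ (?a, ?b) = B $$ (?a, ?b)" using assms(3) by (simp add: agree_off_def)
  then show "mat_delete A i j $$ (a, b) = mat_delete B i j $$ (a, b)"
    using A B ab by (simp add: mat_delete_def insert_index_def)
qed (use A B in auto)

lemma mat_delete_mats_over:
  assumes "B \<in> mats_over n I" "i < n"
  shows "mat_delete B i i \<in> mats_over (n - 1) (delete_family I i)"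
  using assms by (auto simp: mats_over_def mat_delete_def delete_family_def insert_index_def)

text \<open>Once row and column \<open>i\<close> are fixed, a matrix is recovered from its minor,
  which is one of the smaller singular matrices. Relative to \<open>N ^ n\<^sup>2\<close> and
  \<open>N ^ (n - 1)\<^sup>2\<close>, the condition on the minor is thus no more frequent than
  singularity at size \<open>n - 1\<close>.\<close>

lemma card_singular_minor:
  assumes fin: "\<And>i j. finite (I i j)" and card: "\<And>i j. card (I i j) \<le> N" and i: "i < n"
  shows "real (card {B \<in> mats_over n I. det (mat_delete B i i) = 0}) * real N ^ (n - 1)\<^sup>2
    \<le> real (card (singular_mats (n - 1) (delete_family I i))) * real N ^ n\<^sup>2"
proof -
  define T where "T = {B \<in> mats_over n I. det (mat_delete B i i) = 0}"
  define K where "K = ({..<n} - {i}) \<times> ({..<n} - {i})"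
  define S where "S = singular_mats (n - 1) (delete_family I i)"
  have finS: "finite S"
    using finite_mats_over[of "delete_family I i" "n - 1"] fin
    by (simp add: S_def singular_mats_def delete_family_def)
  have "real (card T) * real N ^ card K \<le> real (card S) * real N ^ n\<^sup>2"
  proof (rule card_le_fibers[OF fin card])
    fix A assume "A \<in> T"
    let ?F = "{B \<in> T. agree_off n K A B}"
    have "inj_on (\<lambda>B. mat_delete B i i) ?F"
    proof (rule inj_onI)
      fix B B' assume B: "B \<in> ?F" "B' \<in> ?F" and eq: "mat_delete B i i = mat_delete B' i i"
      have car: "B \<in> carrier_mat n n" "B' \<in> carrier_mat n n"
        using B by (auto simp: T_def mats_over_def)
      have "B $$ (a, b) = B' $$ (a, b)" if "a < n" "b < n" for a b
      proof (cases "(a, b) \<in> K")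
        case True
        then show ?thesis using mat_delete_eq_imp_entry_eq[OF car eq i i] that by (auto simp: K_def)
      next
        case False
        then show ?thesis using B that by (simp add: agree_off_def)
      qed
      then show "B = B'" using car by (intro eq_matI) auto
    qed
    moreover have "(\<lambda>B. mat_delete B i i) ` ?F \<subseteq> S"
      using mat_delete_mats_over[OF _ i] by (auto simp: T_def S_def singular_mats_def)
    ultimately show "real (card ?F) \<le> real (card S)"
      using card_inj_on_le finS by (metis of_nat_le_iff)
  qed (auto simp: T_def K_def)
  moreover have "card K = (n - 1)\<^sup>2"
    using i by (simp add: K_def card_cartesian_product power2_eq_square)
  ultimately show ?thesis by (simp add: T_def S_def)
qed

section \<open>Singular matrices: saving one factor \<open>N\<close>\<close>

text \<open>The determinant is affine in entry \<open>(i, j)\<close> with slope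
  \<open>cofactor A i j\<close>; when the slope is nonzero, the determinant recovers the
  entry.\<close>

lemma agree_off_singleton_eq:
  fixes A B :: "int mat"
  assumes A: "A \<in> carrier_mat n n" and B: "B \<in> carrier_mat n n" and ij: "i < n" "j < n"
    and agree: "agree_off n {(i, j)} A B" and det: "det A = det B" and cof: "cofactor A i j \<noteq> 0"
  shows "A = B"
proof -
  have "det A - det B = (A $$ (i, j) - B $$ (i, j)) * cofactor A i j"
    using agree by (intro det_diff_single_entry[OF A B ij]) (auto simp: agree_off_def)
  with det cof have "A $$ (i, j) = B $$ (i, j)" by simp
  with agree A B show ?thesis by (intro eq_matI) (auto simp: agree_off_def)
qed

text \<open>Either the minor at \<open>(0, 0)\<close> is singular, which the induction hypothesis
  covers, or it is a nonzero slope and \<open>det B = 0\<close> fixes entry \<open>(0, 0)\<close>.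
  Each size adds one more term \<open>1 / N\<close> to the proportion.\<close>

lemma card_singular_le:
  assumes "\<And>i j. finite (I i j)" and "\<And>i j. card (I i j) \<le> N" and N: "N > 0"
  shows "real N * real (card (singular_mats n I)) \<le> real n * real N ^ n\<^sup>2"
  using assms(1,2)
proof (induction n arbitrary: I)
  case 0
  have "singular_mats 0 I = {}" by (auto simp: singular_mats_def mats_over_def)
  then show ?case by simp
next
  case (Suc n)
  note fin = Suc.prems(1) and card = Suc.prems(2)
  define X where "X = {B \<in> mats_over (Suc n) I. det (mat_delete B 0 0) = 0}"
  define Y where "Y = {B \<in> singular_mats (Suc n) I. det (mat_delete B 0 0) \<noteq> 0}"
  have finM: "finite (mats_over (Suc n) I)" using fin by (rule finite_mats_over)
  have "card (singular_mats (Suc n) I) \<le> card (X \<union> Y)"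
    using finM by (intro card_mono) (auto simp: X_def Y_def singular_mats_def)
  then have le: "real (card (singular_mats (Suc n) I)) \<le> real (card X) + real (card Y)"
    using card_Un_le[of X Y] by linarith
  have Y: "real (card Y) * real N ^ card {(0::nat, 0::nat)} \<le> 1 * real N ^ (Suc n)\<^sup>2"
  proof (rule card_le_fibers[OF fin card])
    fix A assume A: "A \<in> Y"
    let ?F = "{B \<in> Y. agree_off (Suc n) {(0, 0)} A B}"
    have "?F \<subseteq> {A}"
    proof
      fix B assume B: "B \<in> ?F"
      have "A = B"
        using A B by (intro agree_off_singleton_eq[of A "Suc n" B 0 0])
          (auto simp: Y_def singular_mats_def mats_over_def cofactor_def)
      then show "B \<in> {A}" by simp
    qed
    then show "real (card ?F) \<le> 1" using card_mono[of "{A}" ?F] by simp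
  qed (auto simp: Y_def singular_mats_def)
  have X: "real N * real (card X) \<le> real n * real N ^ (Suc n)\<^sup>2"
  proof -
    let ?S = "singular_mats n (delete_family I 0)"
    have IH: "real N * real (card ?S) \<le> real n * real N ^ n\<^sup>2"
      using fin card by (intro Suc.IH) (auto simp: delete_family_def)
    have "real (card X) * real N ^ n\<^sup>2 \<le> real (card ?S) * real N ^ (Suc n)\<^sup>2"
      using card_singular_minor[OF fin card, of 0 "Suc n"] by (simp add: X_def)
    then have "real N * (real (card X) * real N ^ n\<^sup>2) \<le> real N * (real (card ?S) * real N ^ (Suc n)\<^sup>2)"
      by (intro mult_left_mono) auto
    also have "\<dots> = (real N * real (card ?S)) * real N ^ (Suc n)\<^sup>2" by simp
    also have "\<dots> \<le> (real n * real N ^ n\<^sup>2) * real N ^ (Suc n)\<^sup>2"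
      by (intro mult_right_mono IH) auto
    finally have "(real N * real (card X)) * real N ^ n\<^sup>2 \<le> (real n * real N ^ (Suc n)\<^sup>2) * real N ^ n\<^sup>2"
      by (simp only: mult_ac)
    then show ?thesis using N by simp
  qed
  have "real N * real (card (singular_mats (Suc n) I)) \<le> real N * (real (card X) + real (card Y))"
    using le by (intro mult_left_mono) auto
  also have "\<dots> \<le> real (Suc n) * real N ^ (Suc n)\<^sup>2"
    using X Y by (simp add: algebra_simps)
  finally show ?case .
qed

section \<open>Singular matrices: saving almost two factors \<open>N\<close>\<close>

text \<open>All these double deletions remove rows 0, 1 and columns 0, 1. Hence the cofactors at
  \<open>(0, 1)\<close> and \<open>(1, 0)\<close> depend on their respective free entries with the
  same slope up to sign.\<close>

lemma mat_delete_01_00: "mat_delete (mat_delete B 0 1) 0 0 = mat_delete (mat_delete B 0 0) 0 0"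
  and mat_delete_10_00: "mat_delete (mat_delete B 1 0) 0 0 = mat_delete (mat_delete B 0 0) 0 0"
  by (auto intro!: eq_matI simp: mat_delete_def)

text \<open>On \<open>F\<close> the product of the cofactors at \<open>(0, 1)\<close> and
  \<open>(1, 0)\<close> is the constant \<open>m\<close>, since neither
  \<open>mat_delete _ 0 0\<close> nor \<open>mat_delete _ 1 1\<close> sees the two free entries. The
  first cofactor is therefore a divisor of \<open>m\<close>, and it determines the matrix.\<close>

lemma card_singular_fiber_le_divisors:
  assumes n: "n \<ge> 2" and A: "A \<in> carrier_mat n n"
    and m: "m = cofactor A 0 0 * cofactor A 1 1" "m \<noteq> 0"
    and F: "\<And>B. B \<in> F \<Longrightarrow> B \<in> carrier_mat n n \<and> det B = 0 \<and> agree_off n {(0, 1), (1, 0)} A B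
      \<and> det (mat_delete (mat_delete B 0 0) 0 0) \<noteq> 0"
  shows "card F \<le> card {d::int. d dvd m}"
proof (rule card_inj_on_le[where f = "\<lambda>B. cofactor B 0 1"])
  have prod: "cofactor B 0 1 * cofactor B 1 0 = m" if "B \<in> F" for B
  proof -
    have "mat_delete A 0 0 = mat_delete B 0 0" "mat_delete A 1 1 = mat_delete B 1 1"
      using F[OF that] by (auto intro!: mat_delete_cong_agree_off[OF A, of _ "{(0, 1), (1, 0)}"])
    then have "m = cofactor B 0 0 * cofactor B 1 1" by (simp add: m cofactor_def)
    then show ?thesis using cofactor_minor_singular[of B n] F[OF that] n by simp
  qed
  then show "(\<lambda>B. cofactor B 0 1) ` F \<subseteq> {d. d dvd m}" by (auto intro!: dvdI)
  show "finite {d. d dvd m}" using m by (intro finite_divisors_int)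
  show "inj_on (\<lambda>B. cofactor B 0 1) F"
  proof (rule inj_onI)
    fix B B' assume B: "B \<in> F" "B' \<in> F" and eq: "cofactor B 0 1 = cofactor B' 0 1"
    have car: "B \<in> carrier_mat n n" "B' \<in> carrier_mat n n" using F B by auto
    have ent: "B $$ (a, b) = B' $$ (a, b)" if "a < n" "b < n" "(a, b) \<notin> {(0, 1), (1, 0)}" for a b
      using F[OF B(1)] F[OF B(2)] that by (auto simp: agree_off_def)
    \<comment> \<open>A divisor of the nonzero \<open>m\<close> fixes the complementary
      divisor.\<close>
    have "cofactor B 0 1 \<noteq> 0" using prod[OF B(1)] m by auto
    then have eq': "cofactor B 1 0 = cofactor B' 1 0"
      using prod[OF B(1)] prod[OF B(2)] eq by (metis mult_left_cancel)
    have core: "cofactor (mat_delete B 0 1) 0 0 \<noteq> 0" "cofactor (mat_delete B 1 0) 0 0 \<noteq> 0"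
      unfolding cofactor_def mat_delete_01_00 mat_delete_10_00 using F[OF B(1)] by auto
    \<comment> \<open>The only entry of this minor that could still differ is its
      \<open>(0, 0)\<close> entry, which is \<open>B $$ (1, 0)\<close>; its slope is the core minor,
      nonzero on \<open>F\<close>. The transposed argument then recovers
      \<open>B $$ (0, 1)\<close>.\<close>
    have "mat_delete B 0 1 = mat_delete B' 0 1"
    proof (rule agree_off_singleton_eq[where i = 0 and j = 0 and n = "n - 1"])
      show "agree_off (n - 1) {(0, 0)} (mat_delete B 0 1) (mat_delete B' 0 1)"
        unfolding agree_off_def
      proof (intro allI impI)
        fix a b assume "a < n - 1" "b < n - 1" "(a, b) \<notin> {(0, 0)}"
        then show "mat_delete B 0 1 $$ (a, b) = mat_delete B' 0 1 $$ (a, b)"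
          using car ent[of "Suc a" "insert_index 1 b"]
          by (auto simp: mat_delete_def insert_index_def split: if_splits)
      qed
    qed (use car n eq core in \<open>auto simp: cofactor_def\<close>)
    then have 10: "B $$ (1, 0) = B' $$ (1, 0)"
      using mat_delete_eq_imp_entry_eq[OF car] n by auto
    have "mat_delete B 1 0 = mat_delete B' 1 0"
    proof (rule agree_off_singleton_eq[where i = 0 and j = 0 and n = "n - 1"])
      show "agree_off (n - 1) {(0, 0)} (mat_delete B 1 0) (mat_delete B' 1 0)"
        unfolding agree_off_def
      proof (intro allI impI)
        fix a b assume "a < n - 1" "b < n - 1" "(a, b) \<notin> {(0, 0)}"
        then show "mat_delete B 1 0 $$ (a, b) = mat_delete B' 1 0 $$ (a, b)"
          using car ent[of "insert_index 1 a" "Suc b"]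
          by (auto simp: mat_delete_def insert_index_def split: if_splits)
      qed
    qed (use car n eq' core in \<open>auto simp: cofactor_def\<close>)
    then have 01: "B $$ (0, 1) = B' $$ (0, 1)"
      using mat_delete_eq_imp_entry_eq[OF car] n by auto
    show "B = B'"
    proof (rule eq_matI)
      fix a b assume "a < dim_row B'" "b < dim_col B'"
      then show "B $$ (a, b) = B' $$ (a, b)"
        using ent[of a b] 01 10 car by (cases "(a, b) \<in> {(0, 1), (1, 0)}") auto
    qed (use car in auto)
  qed
qed

text \<open>A fibre leaves only entries \<open>(0, 1)\<close> and \<open>(1, 0)\<close> free, so it
  has at most as many members as \<open>m\<close> has divisors, and \<open>m\<close> is bounded by a
  power of \<open>M\<close>.\<close>

lemma card_singular_core_nonsingular_le:
  fixes \<epsilon> :: real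
  assumes n: "n \<ge> 2" and \<epsilon>: "\<epsilon> > 0"
  shows "\<exists>C \<ge> 0. \<forall>N M I. M \<ge> 1 \<longrightarrow> (\<forall>i j. card (I i j) \<le> N \<and> I i j \<subseteq> {- int M..int M}) \<longrightarrow>
    real (card {B \<in> singular_mats n I. det (mat_delete (mat_delete B 0 0) 0 0) \<noteq> 0 \<and>
      cofactor B 0 0 * cofactor B 1 1 \<noteq> 0}) * real N ^ 2 \<le> C * real M powr \<epsilon> * real N ^ n\<^sup>2"
proof -
  \<comment> \<open>The product \<open>m\<close> is at most
    \<open>f\<^sup>2 * M ^ (2 * (n - 1))\<close>, so this exponent turns the divisor bound into a
    multiple of \<open>M powr \<epsilon>\<close>.\<close>
  define \<delta> where "\<delta> = \<epsilon> / (2 * real (n - 1))"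
  have \<delta>: "\<delta> > 0" using n \<epsilon> by (simp add: \<delta>_def)
  obtain C where C: "C \<ge> 1" "\<And>m. m \<noteq> 0 \<Longrightarrow> real (card {d::int. d dvd m}) \<le> C * real_of_int \<bar>m\<bar> powr \<delta>"
    using card_int_divisors_le_powr[OF \<delta>] by blast
  define f :: real where "f = fact (n - 1)"
  show ?thesis
  proof (intro exI[of _ "C * f\<^sup>2 powr \<delta>"] conjI allI impI)
    show "0 \<le> C * f\<^sup>2 powr \<delta>" using C by simp
    fix N M :: nat and I :: "nat \<Rightarrow> nat \<Rightarrow> int set"
    assume M: "M \<ge> 1" and I: "\<forall>i j. card (I i j) \<le> N \<and> I i j \<subseteq> {- int M..int M}"
    define T where "T = {B \<in> singular_mats n I. det (mat_delete (mat_delete B 0 0) 0 0) \<noteq> 0 \<and>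
      cofactor B 0 0 * cofactor B 1 1 \<noteq> 0}"
    have fin: "finite (I i j)" for i j using I finite_subset[of "I i j" "{- int M..int M}"] by simp
    have card: "card (I i j) \<le> N" for i j using I by simp
    have "real (card T) * real N ^ card {(0::nat, 1::nat), (1, 0)} \<le>
        (C * f\<^sup>2 powr \<delta> * real M powr \<epsilon>) * real N ^ n\<^sup>2"
    proof (rule card_le_fibers[OF fin card])
      fix A assume A: "A \<in> T"
      let ?F = "{B \<in> T. agree_off n {(0, 1), (1, 0)} A B}"
      define m where "m = cofactor A 0 0 * cofactor A 1 1"
      have m0: "m \<noteq> 0" using A by (simp add: m_def T_def)
      have car: "A \<in> carrier_mat n n" using A by (simp add: T_def singular_mats_def mats_over_def)
      have ent: "\<bar>A $$ (i, j)\<bar> \<le> int M" if "i < n" "j < n" for i j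
      proof -
        have "A $$ (i, j) \<in> I i j" using A that by (simp add: T_def singular_mats_def mats_over_def)
        with I have "A $$ (i, j) \<in> {- int M..int M}" by blast
        then show ?thesis by auto
      qed
      have cof: "\<bar>cofactor A i i\<bar> \<le> fact (n - 1) * int M ^ (n - 1)" if "i < n" for i
      proof -
        have "\<bar>det (mat_delete A i i)\<bar> \<le> fact (n - 1) * int M ^ (n - 1)"
          using car ent by (intro abs_det_le) (auto simp: mat_delete_def)
        then show ?thesis by (simp add: cofactor_def abs_mult)
      qed
      have "\<bar>m\<bar> \<le> (fact (n - 1) * int M ^ (n - 1)) * (fact (n - 1) * int M ^ (n - 1))"
        unfolding m_def abs_mult using n cof by (intro mult_mono) auto
      then have "real_of_int \<bar>m\<bar> \<le> real_of_int ((fact (n - 1) * int M ^ (n - 1)) * (fact (n - 1) * int M ^ (n - 1)))"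
        by (simp only: of_int_le_iff)
      also have "\<dots> = f\<^sup>2 * real M ^ (2 * (n - 1))"
        by (simp add: f_def power2_eq_square mult_2 power_add mult_ac)
      finally have "real_of_int \<bar>m\<bar> powr \<delta> \<le> (f\<^sup>2 * real M ^ (2 * (n - 1))) powr \<delta>"
        using \<delta> by (intro powr_mono2) auto
      also have "\<dots> = f\<^sup>2 powr \<delta> * real M powr (real (2 * (n - 1)) * \<delta>)"
        using M by (simp add: powr_mult powr_powr flip: powr_realpow)
      also have "real (2 * (n - 1)) * \<delta> = \<epsilon>" using n by (simp add: \<delta>_def)
      finally have "C * real_of_int \<bar>m\<bar> powr \<delta> \<le> C * (f\<^sup>2 powr \<delta> * real M powr \<epsilon>)"
        using C by (intro mult_left_mono) auto
      moreover have "card ?F \<le> card {d. d dvd m}"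
        using m0 by (intro card_singular_fiber_le_divisors[OF n car m_def])
          (auto simp: T_def singular_mats_def mats_over_def)
      ultimately show "real (card ?F) \<le> C * f\<^sup>2 powr \<delta> * real M powr \<epsilon>"
        using C(2)[OF m0] by simp
    qed (use n C in \<open>auto simp: T_def singular_mats_def\<close>)
    then show "real (card {B \<in> singular_mats n I. det (mat_delete (mat_delete B 0 0) 0 0) \<noteq> 0 \<and>
      cofactor B 0 0 * cofactor B 1 1 \<noteq> 0}) * real N ^ 2 \<le> C * f\<^sup>2 powr \<delta> * real M powr \<epsilon> * real N ^ n\<^sup>2"
      by (simp add: T_def power2_eq_square)
  qed
qed

text \<open>A singular core saves one factor \<open>N\<close> by \<open>card_singular_le\<close> at
  size \<open>n - 2\<close>; a nonzero slope in entry \<open>(0, 1)\<close> saves the other, because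
  \<open>det B = 0\<close> then fixes that entry.\<close>

lemma card_singular_core_singular_le:
  assumes n: "n \<ge> 2" and fin: "\<And>i j. finite (I i j)" and card: "\<And>i j. card (I i j) \<le> N"
    and N: "N > 0"
  shows "real (card {B \<in> singular_mats n I. det (mat_delete (mat_delete B 0 0) 0 0) = 0 \<and>
      cofactor B 0 1 \<noteq> 0}) * real N ^ 2 \<le> real n * real N ^ n\<^sup>2"
proof -
  define T where "T = {B \<in> singular_mats n I. det (mat_delete (mat_delete B 0 0) 0 0) = 0 \<and>
      cofactor B 0 1 \<noteq> 0}"
  \<comment> \<open>Free in a fibre are the core block and entry \<open>(0, 1)\<close>; the core
    alone then determines the matrix.\<close>
  define K where "K = insert (0, 1) ({2..<n} \<times> {2..<n})"
  define S where "S = singular_mats (n - 2) (delete_family (delete_family I 0) 0)"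
  have cardK: "card K = Suc ((n - 2)\<^sup>2)"
    by (simp add: K_def card_cartesian_product power2_eq_square)
  have finS: "finite S"
    using finite_mats_over[of "delete_family (delete_family I 0) 0" "n - 2"] fin
    by (simp add: S_def singular_mats_def delete_family_def)
  have "real (card T) * real N ^ card K \<le> real (card S) * real N ^ n\<^sup>2"
  proof (rule card_le_fibers[OF fin card])
    fix A assume "A \<in> T"
    let ?F = "{B \<in> T. agree_off n K A B}"
    let ?g = "\<lambda>B. mat_delete (mat_delete B 0 0) 0 0"
    have "inj_on ?g ?F"
    proof (rule inj_onI)
      fix B B' assume B: "B \<in> ?F" "B' \<in> ?F" and eq: "?g B = ?g B'"
      have car: "B \<in> carrier_mat n n" "B' \<in> carrier_mat n n"
        using B by (auto simp: T_def singular_mats_def mats_over_def)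
      have agree: "agree_off n {(0, 1)} B B'"
        unfolding agree_off_def
      proof (intro allI impI)
        fix a b assume ab: "a < n" "b < n" "(a, b) \<notin> {(0, 1)}"
        show "B $$ (a, b) = B' $$ (a, b)"
        proof (cases "(a, b) \<in> K")
          case True
          then have ge: "a \<ge> 2" "b \<ge> 2" using ab by (auto simp: K_def)
          \<comment> \<open>Deleting index 0 twice shifts both indices by two.\<close>
          have "?g B $$ (a - 2, b - 2) = ?g B' $$ (a - 2, b - 2)" using eq by simp
          moreover have "Suc (Suc (a - 2)) = a" "Suc (Suc (b - 2)) = b" using ge by auto
          ultimately show ?thesis using ge ab car by (simp add: mat_delete_def)
        next
          case False
          then show ?thesis using B ab by (simp add: agree_off_def)
        qed
      qed
      show "B = B'"
        using B n by (intro agree_off_singleton_eq[OF car _ _ agree])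
          (auto simp: T_def singular_mats_def)
    qed
    moreover have "?g ` ?F \<subseteq> S"
    proof
      fix X assume "X \<in> ?g ` ?F"
      then obtain B where B: "B \<in> T" "X = ?g B" by auto
      then have "mat_delete B 0 0 \<in> mats_over (n - 1) (delete_family I 0)"
        using n by (intro mat_delete_mats_over) (auto simp: T_def singular_mats_def)
      then have "X \<in> mats_over (n - 1 - 1) (delete_family (delete_family I 0) 0)"
        unfolding B(2) by (rule mat_delete_mats_over) (use n in simp)
      then show "X \<in> S" using B by (simp add: S_def T_def singular_mats_def numeral_2_eq_2)
    qed
    ultimately show "real (card ?F) \<le> real (card S)"
      using finS by (simp add: card_inj_on_le)
  qed (use n in \<open>auto simp: T_def singular_mats_def K_def\<close>)
  \<comment> \<open>The extra factor \<open>N\<close> is what \<open>card_singular_le\<close> needs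
    in order to bound \<open>card S\<close>.\<close>
  then have "(real (card T) * real N ^ Suc ((n - 2)\<^sup>2)) * real N \<le> (real (card S) * real N ^ n\<^sup>2) * real N"
    unfolding cardK by (intro mult_right_mono) auto
  also have "\<dots> = (real N * real (card S)) * real N ^ n\<^sup>2" by simp
  also have "\<dots> \<le> (real (n - 2) * real N ^ (n - 2)\<^sup>2) * real N ^ n\<^sup>2"
    unfolding S_def using fin card N
    by (intro mult_right_mono card_singular_le) (auto simp: delete_family_def)
  also have "\<dots> \<le> (real n * real N ^ (n - 2)\<^sup>2) * real N ^ n\<^sup>2"
    by (intro mult_right_mono) auto
  finally have "(real (card T) * real N ^ 2) * real N ^ (n - 2)\<^sup>2 \<le> (real n * real N ^ n\<^sup>2) * real N ^ (n - 2)\<^sup>2"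
    by (simp add: mult_ac power2_eq_square)
  then show ?thesis using N by (simp add: T_def)
qed

text \<open>Each fibre is a single matrix. This handles the degenerate 2 by 2 matrices.\<close>

lemma card_two_entries_zero_le:
  assumes fin: "\<And>i j. finite (I i j)" and card: "\<And>i j. card (I i j) \<le> N"
    and pq: "p \<noteq> q" "p \<in> {..<n} \<times> {..<n}" "q \<in> {..<n} \<times> {..<n}"
  shows "real (card {B \<in> mats_over n I. B $$ p = 0 \<and> B $$ q = 0}) * real N ^ 2 \<le> real N ^ n\<^sup>2"
proof -
  define T where "T = {B \<in> mats_over n I. B $$ p = 0 \<and> B $$ q = 0}"
  have "real (card T) * real N ^ card {p, q} \<le> 1 * real N ^ n\<^sup>2"
  proof (rule card_le_fibers[OF fin card])
    fix A assume A: "A \<in> T"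
    let ?F = "{B \<in> T. agree_off n {p, q} A B}"
    have "?F \<subseteq> {A}"
    proof
      fix B assume B: "B \<in> ?F"
      have "B $$ (a, b) = A $$ (a, b)" if "a < n" "b < n" for a b
        using A B that by (cases "(a, b) \<in> {p, q}") (auto simp: T_def agree_off_def)
      with A B have "B = A" by (intro eq_matI) (auto simp: T_def mats_over_def)
      then show "B \<in> {A}" by simp
    qed
    then show "real (card ?F) \<le> 1" using card_mono[of "{A}" ?F] by simp
  qed (use pq in \<open>auto simp: T_def\<close>)
  then show ?thesis using pq by (simp add: T_def power2_eq_square)
qed

text \<open>The induction has to start at size 2, since at size 1 singularity saves only one factor
  \<open>N\<close>. The core is now the empty matrix of determinant 1, so the only split is by
  \<open>m\<close>; if \<open>m = 0\<close>, the diagonal and the off-diagonal both contain a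
  zero.\<close>

lemma card_singular_2_le_powr:
  fixes \<epsilon> :: real
  assumes \<epsilon>: "\<epsilon> > 0"
  shows "\<exists>C \<ge> 0. \<forall>N M I. M \<ge> 1 \<longrightarrow> (\<forall>i j. card (I i j) \<le> N \<and> I i j \<subseteq> {- int M..int M}) \<longrightarrow>
    real (card (singular_mats 2 I)) * real N ^ 2 \<le> C * real M powr \<epsilon> * real N ^ 2\<^sup>2"
proof -
  let ?T = "\<lambda>I. {B \<in> singular_mats 2 I. det (mat_delete (mat_delete B 0 0) 0 0) \<noteq> 0 \<and>
      cofactor B 0 0 * cofactor B 1 1 \<noteq> 0}"
  obtain C where C: "C \<ge> 0" "\<And>N M I. M \<ge> 1 \<Longrightarrow> \<forall>i j. card (I i j) \<le> N \<and> I i j \<subseteq> {- int M..int M} \<Longrightarrow>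
    real (card (?T I)) * real N ^ 2 \<le> C * real M powr \<epsilon> * real N ^ 2\<^sup>2"
    using card_singular_core_nonsingular_le[OF order.refl \<epsilon>] by blast
  show ?thesis
  \<comment> \<open>The 4 counts the pairs of one diagonal and one off-diagonal position;
    \<open>1 \<le> M powr \<epsilon>\<close> brings their bounds into the common form.\<close>
  proof (intro exI[of _ "C + 4"] conjI allI impI)
    show "0 \<le> C + 4" using C by simp
    fix N M :: nat and I :: "nat \<Rightarrow> nat \<Rightarrow> int set"
    assume M: "M \<ge> 1" and I: "\<forall>i j. card (I i j) \<le> N \<and> I i j \<subseteq> {- int M..int M}"
    have fin: "finite (I i j)" for i j using I finite_subset[of "I i j" "{- int M..int M}"] by simp
    have card: "card (I i j) \<le> N" for i j using I by simp
    define Z where "Z p q = {B \<in> mats_over 2 I. B $$ p = 0 \<and> B $$ q = 0}" for p q :: "nat \<times> nat"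
    have "singular_mats 2 I \<subseteq>
      ?T I \<union> (Z (0, 0) (0, 1) \<union> (Z (0, 0) (1, 0) \<union> (Z (1, 1) (0, 1) \<union> Z (1, 1) (1, 0))))"
    proof
      fix B assume B: "B \<in> singular_mats 2 I"
      then have car: "B \<in> carrier_mat 2 2" and det: "det B = 0" and mem: "B \<in> mats_over 2 I"
        by (auto simp: singular_mats_def mats_over_def)
      have single: "det (mat_delete B i j) = mat_delete B i j $$ (0, 0)" for i j
        using mat_delete_carrier[OF car, of i j] by (intro det_single) simp
      have cof: "cofactor B 0 0 = B $$ (1, 1)" "cofactor B 1 1 = B $$ (0, 0)"
        "cofactor B 0 1 = - B $$ (1, 0)" "cofactor B 1 0 = - B $$ (0, 1)"
        unfolding cofactor_def single using car by (simp_all add: mat_delete_def)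
      have "mat_delete (mat_delete B 0 0) 0 0 \<in> carrier_mat 0 0"
        using mat_delete_carrier[OF mat_delete_carrier[OF car]] by simp
      then have "det (mat_delete (mat_delete B 0 0) 0 0) = 1" by (rule det_dim_zero)
      moreover have "(B $$ (1, 1) = 0 \<or> B $$ (0, 0) = 0) \<and> (B $$ (1, 0) = 0 \<or> B $$ (0, 1) = 0)"
        if "cofactor B 0 0 * cofactor B 1 1 = 0"
        using cofactor_minor_singular[OF car order.refl det] that unfolding cof by auto
      ultimately show "B \<in> ?T I \<union> (Z (0, 0) (0, 1) \<union> (Z (0, 0) (1, 0) \<union> (Z (1, 1) (0, 1) \<union> Z (1, 1) (1, 0))))"
        using B mem by (cases "cofactor B 0 0 * cofactor B 1 1 = 0") (auto simp: Z_def)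
    qed
    moreover have "finite (mats_over 2 I)" using fin by (rule finite_mats_over)
    ultimately have "card (singular_mats 2 I) \<le>
      card (?T I \<union> (Z (0, 0) (0, 1) \<union> (Z (0, 0) (1, 0) \<union> (Z (1, 1) (0, 1) \<union> Z (1, 1) (1, 0)))))"
      by (intro card_mono) (auto simp: Z_def singular_mats_def)
    also have "\<dots> \<le> card (?T I) + (card (Z (0, 0) (0, 1)) + (card (Z (0, 0) (1, 0)) +
        (card (Z (1, 1) (0, 1)) + card (Z (1, 1) (1, 0)))))"
      by (intro order.trans[OF card_Un_le] add_left_mono card_Un_le)
    finally have "real (card (singular_mats 2 I)) * real N ^ 2 \<le>
        (real (card (?T I)) + (real (card (Z (0, 0) (0, 1))) + (real (card (Z (0, 0) (1, 0))) +
        (real (card (Z (1, 1) (0, 1))) + real (card (Z (1, 1) (1, 0))))))) * real N ^ 2"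
      unfolding of_nat_add[symmetric] by (intro mult_right_mono) (auto simp only: of_nat_le_iff zero_le_power of_nat_0_le_iff)
    also have "\<dots> = real (card (?T I)) * real N ^ 2 + (real (card (Z (0, 0) (0, 1))) * real N ^ 2
        + (real (card (Z (0, 0) (1, 0))) * real N ^ 2
        + (real (card (Z (1, 1) (0, 1))) * real N ^ 2 + real (card (Z (1, 1) (1, 0))) * real N ^ 2)))"
      by (simp only: distrib_right)
    also have "\<dots> \<le> C * real M powr \<epsilon> * real N ^ 2\<^sup>2 + (real N ^ 2\<^sup>2 + (real N ^ 2\<^sup>2
        + (real N ^ 2\<^sup>2 + real N ^ 2\<^sup>2)))"
      unfolding Z_def by (intro add_mono C(2)[OF M I] card_two_entries_zero_le[OF fin card]) auto
    also have "\<dots> = C * real M powr \<epsilon> * real N ^ 2\<^sup>2 + 4 * (1 * real N ^ 2\<^sup>2)" by simp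
    also have "\<dots> \<le> C * real M powr \<epsilon> * real N ^ 2\<^sup>2 + 4 * (real M powr \<epsilon> * real N ^ 2\<^sup>2)"
      using M \<epsilon> by (intro add_left_mono mult_left_mono mult_right_mono ge_one_powr_ge_zero) auto
    finally show "real (card (singular_mats 2 I)) * real N ^ 2 \<le> (C + 4) * real M powr \<epsilon> * real N ^ 2\<^sup>2"
      by (simp add: algebra_simps)
  qed
qed

text \<open>Singular matrices fall into four classes: \<open>m \<noteq> 0\<close> with nonsingular
  core, nonzero \<open>cofactor B 0 1\<close> with singular core, and a vanishing principal minor at
  index 0 or at index 1.\<close>

lemma card_singular_le_powr:
  fixes \<epsilon> :: real
  assumes n: "n \<ge> 2" and \<epsilon>: "\<epsilon> > 0"
  shows "\<exists>C \<ge> 0. \<forall>N M I. N \<ge> 1 \<longrightarrow> M \<ge> 1 \<longrightarrow> (\<forall>i j. card (I i j) \<le> N \<and> I i j \<subseteq> {- int M..int M}) \<longrightarrow>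
    real (card (singular_mats n I)) * real N ^ 2 \<le> C * real M powr \<epsilon> * real N ^ n\<^sup>2"
  using n
proof (induction n rule: nat_induct_at_least)
  case base
  show ?case using card_singular_2_le_powr[OF \<epsilon>] by blast
next
  case (Suc n)
  let ?T2 = "\<lambda>I. {B \<in> singular_mats (Suc n) I. det (mat_delete (mat_delete B 0 0) 0 0) \<noteq> 0 \<and>
      cofactor B 0 0 * cofactor B 1 1 \<noteq> 0}"
  let ?T1 = "\<lambda>I. {B \<in> singular_mats (Suc n) I. det (mat_delete (mat_delete B 0 0) 0 0) = 0 \<and>
      cofactor B 0 1 \<noteq> 0}"
  let ?X = "\<lambda>i I. {B \<in> mats_over (Suc n) I. det (mat_delete B i i) = 0}"
  have n2: "Suc n \<ge> 2" using Suc.hyps by simp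
  obtain C where C: "C \<ge> 0" "\<And>N M I. N \<ge> 1 \<Longrightarrow> M \<ge> 1 \<Longrightarrow>
      \<forall>i j. card (I i j) \<le> N \<and> I i j \<subseteq> {- int M..int M} \<Longrightarrow>
      real (card (singular_mats n I)) * real N ^ 2 \<le> C * real M powr \<epsilon> * real N ^ n\<^sup>2"
    using Suc.IH by blast
  obtain C' where C': "C' \<ge> 0" "\<And>N M I. M \<ge> 1 \<Longrightarrow> \<forall>i j. card (I i j) \<le> N \<and> I i j \<subseteq> {- int M..int M} \<Longrightarrow>
      real (card (?T2 I)) * real N ^ 2 \<le> C' * real M powr \<epsilon> * real N ^ (Suc n)\<^sup>2"
    using card_singular_core_nonsingular_le[OF n2 \<epsilon>] by blast
  show ?case
  \<comment> \<open>\<open>C'\<close> serves the nonsingular core, \<open>Suc n\<close> the singular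
    core, and \<open>2 * C\<close> the two principal minors, which are bounded by induction.\<close>
  proof (intro exI[of _ "C' + Suc n + 2 * C"] conjI allI impI)
    show "0 \<le> C' + Suc n + 2 * C" using C C' by simp
    fix N M :: nat and I :: "nat \<Rightarrow> nat \<Rightarrow> int set"
    assume N: "N \<ge> 1" and M: "M \<ge> 1" and I: "\<forall>i j. card (I i j) \<le> N \<and> I i j \<subseteq> {- int M..int M}"
    have fin: "finite (I i j)" for i j using I finite_subset[of "I i j" "{- int M..int M}"] by simp
    have card: "card (I i j) \<le> N" for i j using I by simp
    let ?R = "real N ^ (Suc n)\<^sup>2"
    have "singular_mats (Suc n) I \<subseteq> ?T2 I \<union> (?T1 I \<union> (?X 0 I \<union> ?X 1 I))"
    proof
      fix B assume B: "B \<in> singular_mats (Suc n) I"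
      then have car: "B \<in> carrier_mat (Suc n) (Suc n)" and det: "det B = 0"
        and mem: "B \<in> mats_over (Suc n) I"
        by (auto simp: singular_mats_def mats_over_def)
      have "cofactor B 0 0 * cofactor B 1 1 = cofactor B 0 1 * cofactor B 1 0"
        by (rule cofactor_minor_singular[OF car n2 det])
      \<comment> \<open>If \<open>m \<noteq> 0\<close>, then its factor
        \<open>cofactor B 0 1\<close> is nonzero too, so the classes cover everything.\<close>
      then have "cofactor B 0 1 \<noteq> 0 \<or> cofactor B 0 0 * cofactor B 1 1 = 0" by auto
      moreover have "cofactor B i i = 0 \<longleftrightarrow> det (mat_delete B i i) = 0" for i
        by (simp add: cofactor_def)
      ultimately show "B \<in> ?T2 I \<union> (?T1 I \<union> (?X 0 I \<union> ?X 1 I))"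
        using B mem by auto
    qed
    moreover have "finite (mats_over (Suc n) I)" using fin by (rule finite_mats_over)
    ultimately have "card (singular_mats (Suc n) I) \<le> card (?T2 I \<union> (?T1 I \<union> (?X 0 I \<union> ?X 1 I)))"
      by (intro card_mono) (auto simp: singular_mats_def)
    also have "\<dots> \<le> card (?T2 I) + (card (?T1 I) + (card (?X 0 I) + card (?X 1 I)))"
      by (intro order.trans[OF card_Un_le] add_left_mono card_Un_le)
    finally have "real (card (singular_mats (Suc n) I)) * real N ^ 2 \<le>
        (real (card (?T2 I)) + (real (card (?T1 I)) + (real (card (?X 0 I)) + real (card (?X 1 I))))) * real N ^ 2"
      unfolding of_nat_add[symmetric]
      by (intro mult_right_mono) (auto simp only: of_nat_le_iff zero_le_power of_nat_0_le_iff)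
    also have "\<dots> = real (card (?T2 I)) * real N ^ 2 + (real (card (?T1 I)) * real N ^ 2
        + (real (card (?X 0 I)) * real N ^ 2 + real (card (?X 1 I)) * real N ^ 2))"
      by (simp only: distrib_right)
    also have "\<dots> \<le> C' * real M powr \<epsilon> * ?R + (real (Suc n) * (real M powr \<epsilon> * ?R)
        + (C * real M powr \<epsilon> * ?R + C * real M powr \<epsilon> * ?R))"
    proof (intro add_mono C'(2)[OF M I])
      have "real (card (?T1 I)) * real N ^ 2 \<le> real (Suc n) * (1 * ?R)"
        using card_singular_core_singular_le[OF n2 fin card] N by simp
      also have "\<dots> \<le> real (Suc n) * (real M powr \<epsilon> * ?R)"
        using M \<epsilon> by (intro mult_left_mono mult_right_mono ge_one_powr_ge_zero) auto
      finally show "real (card (?T1 I)) * real N ^ 2 \<le> real (Suc n) * (real M powr \<epsilon> * ?R)" .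
      have X: "real (card (?X i I)) * real N ^ 2 \<le> C * real M powr \<epsilon> * ?R" if "i < Suc n" for i
      proof -
        let ?S = "singular_mats n (delete_family I i)"
        have "real (card (?X i I)) * real N ^ n\<^sup>2 \<le> real (card ?S) * ?R"
          using card_singular_minor[OF fin card that] by simp
        then have "real (card (?X i I)) * real N ^ n\<^sup>2 * real N ^ 2 \<le> real (card ?S) * ?R * real N ^ 2"
          by (intro mult_right_mono) auto
        also have "\<dots> = (real (card ?S) * real N ^ 2) * ?R" by (simp only: mult_ac)
        also have "\<dots> \<le> (C * real M powr \<epsilon> * real N ^ n\<^sup>2) * ?R"
          using I by (intro mult_right_mono C(2)[OF N M]) (auto simp: delete_family_def)
        finally have "(real (card (?X i I)) * real N ^ 2) * real N ^ n\<^sup>2 \<le> (C * real M powr \<epsilon> * ?R) * real N ^ n\<^sup>2"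
          by (simp only: mult_ac)
        then show ?thesis using N by simp
      qed
      show "real (card (?X 0 I)) * real N ^ 2 \<le> C * real M powr \<epsilon> * ?R"
        and "real (card (?X 1 I)) * real N ^ 2 \<le> C * real M powr \<epsilon> * ?R"
        using n2 by (intro X; simp)+
    qed
    also have "\<dots> = (C' + Suc n + 2 * C) * real M powr \<epsilon> * ?R" by (simp only: distrib_right mult_2 add.assoc mult.assoc)
    finally show "real (card (singular_mats (Suc n) I)) * real N ^ 2 \<le>
        (C' + Suc n + 2 * C) * real M powr \<epsilon> * ?R" .
  qed
qed

section \<open>Integer eigenvalues\<close>

text \<open>The eigenvector equation is read off at a coordinate of maximal modulus
  \<open>w\<close>, where the right-hand side has \<open>n\<close> terms of modulus at most
  \<open>k * w\<close>.\<close>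

lemma int_eigenvalue_abs_le:
  assumes A: "A \<in> bounded_int_mats n k"
    and ev: "eigenvalue (map_mat complex_of_int A) (complex_of_int l)"
  shows "\<bar>l\<bar> \<le> int n * int k"
proof -
  have car: "A \<in> carrier_mat n n" using A by (simp add: bounded_int_mats_def)
  have ent: "\<bar>A $$ (i, j)\<bar> \<le> int k" if "i < n" "j < n" for i j
  proof -
    have "A $$ (i, j) \<in> elements_mat A" using that car by (intro elements_matI) auto
    then have "A $$ (i, j) \<in> {- int k..int k}" using A by (auto simp: bounded_int_mats_def)
    then show ?thesis by auto
  qed
  obtain v where v: "v \<in> carrier_vec n" "v \<noteq> 0\<^sub>v n"
    "map_mat complex_of_int A *\<^sub>v v = complex_of_int l \<cdot>\<^sub>v v"
    using ev car by (auto simp: eigenvalue_def eigenvector_def)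
  then obtain i0 where i0: "i0 < n" "v $ i0 \<noteq> 0"
    by (metis carrier_vecD eq_vecI index_zero_vec(1,2))
  define w where "w = Max ((\<lambda>i. cmod (v $ i)) ` {..<n})"
  have le: "cmod (v $ i) \<le> w" if "i < n" for i
    using that by (auto simp: w_def intro!: Max_ge)
  have "w \<in> (\<lambda>i. cmod (v $ i)) ` {..<n}"
    unfolding w_def using i0 by (intro Max_in) auto
  then obtain i where i: "i < n" "w = cmod (v $ i)" by auto
  have "0 < cmod (v $ i0)" using i0 by simp
  then have w: "w > 0" using le[OF i0(1)] by linarith
  have "complex_of_int l * v $ i = (\<Sum>j<n. complex_of_int (A $$ (i, j)) * v $ j)"
  proof -
    have "complex_of_int l * v $ i = (complex_of_int l \<cdot>\<^sub>v v) $ i" using v i by simp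
    also have "\<dots> = (map_mat complex_of_int A *\<^sub>v v) $ i" by (simp only: v(3))
    also have "\<dots> = (\<Sum>j<n. complex_of_int (A $$ (i, j)) * v $ j)"
      using v(1) i(1) car by (auto simp: scalar_prod_def atLeast0LessThan)
    finally show ?thesis .
  qed
  then have "cmod (complex_of_int l * v $ i) \<le> (\<Sum>j<n. cmod (complex_of_int (A $$ (i, j)) * v $ j))"
    using norm_sum by simp
  also have "\<dots> \<le> (\<Sum>j<n. real k * w)"
    unfolding norm_mult
  proof (intro sum_mono mult_mono)
    fix j assume "j \<in> {..<n}"
    then have j: "j < n" by simp
    have "real_of_int \<bar>A $$ (i, j)\<bar> \<le> real_of_int (int k)" using ent[OF i(1) j] by (simp only: of_int_le_iff)
    then show "cmod (complex_of_int (A $$ (i, j))) \<le> real k" by simp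
    show "cmod (v $ j) \<le> w" using le[OF j] .
  qed auto
  finally have "\<bar>real_of_int l\<bar> * w \<le> (real n * real k) * w"
    using i by (simp add: norm_mult)
  then have "\<bar>real_of_int l\<bar> \<le> real n * real k" using w by simp
  then have "real_of_int \<bar>l\<bar> \<le> real_of_int (int n * int k)" by simp
  then show ?thesis by (simp only: of_int_le_iff)
qed

lemma det_zero_of_int_eigenvalue:
  assumes A: "A \<in> carrier_mat n n"
    and ev: "eigenvalue (map_mat complex_of_int A) (complex_of_int l)"
  shows "det (A - l \<cdot>\<^sub>m 1\<^sub>m n) = 0"
proof -
  have "char_matrix (map_mat complex_of_int A) (complex_of_int l) = map_mat complex_of_int (A - l \<cdot>\<^sub>m 1\<^sub>m n)"
    using A by (intro eq_matI) (auto simp: char_matrix_def)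
  moreover have "det (char_matrix (map_mat complex_of_int A) (complex_of_int l)) = 0"
    using ev eigenvalue_det[of "map_mat complex_of_int A" n] A by simp
  ultimately show ?thesis by simp
qed

text \<open>Any diagonal entry of \<open>D\<close> is a rational root of the monic integer
  polynomial \<open>char_poly A\<close>, hence an integer.\<close>

lemma has_int_eigenvalue_if_diagonalizable_over_rat:
  assumes A: "A \<in> carrier_mat n n" and n: "n > 0" and diag: "diagonalizable_over_rat A"
  shows "has_int_eigenvalue A"
proof -
  obtain D where D: "diagonal_mat D" "similar_mat (map_mat rat_of_int A) D"
    using diag by (auto simp: diagonalizable_over_rat_def)
  obtain m P Q where "{map_mat rat_of_int A, D, P, Q} \<subseteq> carrier_mat m m"
    using similar_matD[OF D(2)] by blast
  then have "D \<in> carrier_mat m m" "dim_row (map_mat rat_of_int A) = m" by auto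
  with A have car: "D \<in> carrier_mat n n" by simp
  define x where "x = D $$ (0, 0)"
  have "upper_triangular D" using D(1) car by (auto simp: diagonal_mat_def upper_triangular_def)
  then have "char_poly D = (\<Prod>a\<leftarrow>diag_mat D. [:- a, 1:])" by (rule char_poly_upper_triangular[OF car])
  moreover have "x \<in> set (diag_mat D)" using car n by (auto simp: diag_mat_def x_def)
  ultimately have "poly (char_poly D) x = 0"
    by (auto simp: poly_prod_list)
  then have root: "poly (map_poly rat_of_int (char_poly A)) x = 0"
    using char_poly_similar[OF D(2)] of_int_hom.char_poly_hom[OF A] by metis
  have "lead_coeff (char_poly A) = 1" using degree_monic_char_poly[OF A] by simp
  \<comment> \<open>The rational root theorem, in the form that a rational algebraic integer is an
    integer.\<close>
  then have "algebraic_int x" using root by (auto simp: algebraic_int_altdef_ipoly)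
  moreover have "x \<in> \<rat>" using Rats_of_rat[of x, where 'a = rat] by simp
  ultimately have "x \<in> \<int>" by (rule rational_algebraic_int_is_int)
  then obtain l where "x = rat_of_int l" by (auto elim: Ints_cases)
  then have "poly (char_poly A) l = 0" using root by simp
  then have "poly (map_poly complex_of_int (char_poly A)) (complex_of_int l) = 0" by simp
  then have "eigenvalue (map_mat complex_of_int A) (complex_of_int l)"
    using eigenvalue_root_char_poly[of "map_mat complex_of_int A" n] A
      of_int_hom.char_poly_hom[OF A, where 'a = complex] by simp
  then show ?thesis by (auto simp: has_int_eigenvalue_def)
qed

section \<open>Union bound over the possible eigenvalues\<close>

text \<open>Subtracting \<open>l\<close> times the identity is injective and only translates the
  diagonal ranges, which keep their \<open>2 * k + 1\<close> elements.\<close>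

lemma card_det_shift_zero_le:
  assumes I: "\<And>i j. I i j = (if i = j then {- int k - l..int k - l} else {- int k..int k})"
  shows "card {A \<in> bounded_int_mats n k. det (A - l \<cdot>\<^sub>m 1\<^sub>m n) = 0} \<le> card (singular_mats n I)"
proof (rule card_inj_on_le[where f = "\<lambda>A. A - l \<cdot>\<^sub>m 1\<^sub>m n"])
  let ?S = "{A \<in> bounded_int_mats n k. det (A - l \<cdot>\<^sub>m 1\<^sub>m n) = 0}"
  show "inj_on (\<lambda>A. A - l \<cdot>\<^sub>m 1\<^sub>m n) ?S"
  proof (rule inj_onI)
    fix A B assume AB: "A \<in> ?S" "B \<in> ?S" and eq: "A - l \<cdot>\<^sub>m 1\<^sub>m n = B - l \<cdot>\<^sub>m 1\<^sub>m n"
    then have car: "A \<in> carrier_mat n n" "B \<in> carrier_mat n n" by (auto simp: bounded_int_mats_def)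
    have "A $$ (i, j) = B $$ (i, j)" if "i < n" "j < n" for i j
    proof -
      have "(A - l \<cdot>\<^sub>m 1\<^sub>m n) $$ (i, j) = (B - l \<cdot>\<^sub>m 1\<^sub>m n) $$ (i, j)" using eq by simp
      then show ?thesis using that car by (auto split: if_splits)
    qed
    then show "A = B" using car by (intro eq_matI) auto
  qed
  show "(\<lambda>A. A - l \<cdot>\<^sub>m 1\<^sub>m n) ` ?S \<subseteq> singular_mats n I"
  proof
    fix B assume "B \<in> (\<lambda>A. A - l \<cdot>\<^sub>m 1\<^sub>m n) ` ?S"
    then obtain A where A: "A \<in> bounded_int_mats n k" "det B = 0" "B = A - l \<cdot>\<^sub>m 1\<^sub>m n" by auto
    have "A $$ (i, j) \<in> {- int k..int k}" if "i < n" "j < n" for i j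
    proof -
      have "A $$ (i, j) \<in> elements_mat A"
        using that A(1) by (intro elements_matI) (auto simp: bounded_int_mats_def)
      then show ?thesis using A(1) by (auto simp: bounded_int_mats_def)
    qed
    then show "B \<in> singular_mats n I"
      using A by (auto simp: singular_mats_def mats_over_def bounded_int_mats_def I)
  qed
  show "finite (singular_mats n I)"
    using finite_mats_over[of I n] by (simp add: I singular_mats_def)
qed

text \<open>There are at most \<open>n * N\<close> candidates \<open>l\<close>, and each one saves
  \<open>N ^ 2\<close> up to \<open>k powr \<epsilon>\<close>; one factor \<open>N \<ge> k\<close>
  remains.\<close>

lemma card_has_int_eigenvalue_le:
  fixes \<epsilon> :: real
  assumes n: "n \<ge> 2" and \<epsilon>: "\<epsilon> > 0"
  shows "\<exists>C > 0. \<forall>k \<ge> 1. real (card {A \<in> bounded_int_mats n k. has_int_eigenvalue A}) * real k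
    \<le> C * real k powr \<epsilon> * real (card (bounded_int_mats n k))"
proof -
  obtain C where C: "C \<ge> 0" "\<And>N M I. N \<ge> 1 \<Longrightarrow> M \<ge> 1 \<Longrightarrow>
      \<forall>i j. card (I i j) \<le> N \<and> I i j \<subseteq> {- int M..int M} \<Longrightarrow>
      real (card (singular_mats n I)) * real N ^ 2 \<le> C * real M powr \<epsilon> * real N ^ n\<^sup>2"
    using card_singular_le_powr[OF n \<epsilon>] by blast
  \<comment> \<open>The factor \<open>n\<close> comes from the number of candidates, and
    \<open>(n + 1) powr \<epsilon>\<close> from the entry bound \<open>(n + 1) * k\<close>.\<close>
  define C' where "C' = real n * C * real (n + 1) powr \<epsilon>"
  have C'0: "C' \<ge> 0" using C by (simp add: C'_def)
  have main: "real (card {A \<in> bounded_int_mats n k. has_int_eigenvalue A}) * real k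
    \<le> C' * real k powr \<epsilon> * real (card (bounded_int_mats n k))" if k: "k \<ge> 1" for k
  proof -
    define S where "S l = {A \<in> bounded_int_mats n k. det (A - l \<cdot>\<^sub>m 1\<^sub>m n) = 0}" for l
    define E where "E = {A \<in> bounded_int_mats n k. has_int_eigenvalue A}"
    define N where "N = 2 * k + 1"
    define L where "L = {- (int n * int k)..int n * int k}"
    have finS: "finite (S l)" for l using finite_bounded_int_mats by (simp add: S_def)
    have S: "real (card (S l)) * real N ^ 2 \<le> C' / n * real k powr \<epsilon> * real N ^ n\<^sup>2" if l: "l \<in> L" for l
    proof -
      define I where "I i j = (if i = j then {- int k - l..int k - l} else {- int k..int k})" for i j :: nat
      \<comment> \<open>Shifted entries are at most \<open>k + \<bar>l\<bar>\<close> in absolute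
        value, with \<open>\<bar>l\<bar> \<le> n * k\<close>.\<close>
      let ?M = "(n + 1) * k"
      have "real (card (S l)) \<le> real (card (singular_mats n I))"
        unfolding S_def using card_det_shift_zero_le[of I k l n] by (simp add: I_def)
      then have "real (card (S l)) * real N ^ 2 \<le> real (card (singular_mats n I)) * real N ^ 2"
        by (intro mult_right_mono) auto
      also have "\<dots> \<le> C * real ?M powr \<epsilon> * real N ^ n\<^sup>2"
      proof (rule C(2))
        show "\<forall>i j. card (I i j) \<le> N \<and> I i j \<subseteq> {- int ?M..int ?M}"
        proof (intro allI conjI)
          fix i j
          show "card (I i j) \<le> N" by (simp add: I_def N_def)
          show "I i j \<subseteq> {- int ?M..int ?M}"
            using l by (auto simp: I_def L_def algebra_simps)
        qed
      qed (use k in \<open>auto simp: N_def\<close>)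
      also have "C * real ?M powr \<epsilon> = C' / n * real k powr \<epsilon>"
        using n by (simp only: of_nat_mult powr_mult of_nat_0_le_iff C'_def) simp
      finally show ?thesis .
    qed
    have "E \<subseteq> (\<Union>l\<in>L. S l)"
    proof
      fix A assume "A \<in> E"
      then obtain l where A: "A \<in> bounded_int_mats n k"
        and l: "eigenvalue (map_mat complex_of_int A) (complex_of_int l)"
        by (auto simp: E_def has_int_eigenvalue_def)
      have "l \<in> L" using int_eigenvalue_abs_le[OF A l] by (auto simp: L_def)
      moreover have "A \<in> S l"
        using det_zero_of_int_eigenvalue[OF _ l, of n] A by (simp add: S_def bounded_int_mats_def)
      ultimately show "A \<in> (\<Union>l\<in>L. S l)" by blast
    qed
    then have "card E \<le> card (\<Union>l\<in>L. S l)" using finS by (intro card_mono) (auto simp: L_def)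
    also have "\<dots> \<le> (\<Sum>l\<in>L. card (S l))" by (intro card_UN_le) (simp add: L_def)
    finally have "real (card E) \<le> (\<Sum>l\<in>L. real (card (S l)))"
      unfolding of_nat_sum[symmetric] of_nat_le_iff .
    then have "real (card E) * real N ^ 2 \<le> (\<Sum>l\<in>L. real (card (S l))) * real N ^ 2"
      by (intro mult_right_mono) auto
    also have "\<dots> = (\<Sum>l\<in>L. real (card (S l)) * real N ^ 2)" by (rule sum_distrib_right)
    also have "\<dots> \<le> real (card L) * (C' / n * real k powr \<epsilon> * real N ^ n\<^sup>2)"
      using S by (rule sum_bounded_above)
    also have "\<dots> \<le> (real n * real N) * (C' / n * real k powr \<epsilon> * real N ^ n\<^sup>2)"
    proof (rule mult_right_mono)
      have "int (card L) = 2 * (int n * int k) + 1" by (simp add: L_def)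
      also have "\<dots> \<le> int (n * N)" using n by (simp add: N_def algebra_simps)
      finally have "card L \<le> n * N" by (simp only: of_nat_le_iff)
      then show "real (card L) \<le> real n * real N" by (simp only: of_nat_mult[symmetric] of_nat_le_iff)
    qed (use C'0 in simp)
    also have "\<dots> = (C' * real k powr \<epsilon> * real N ^ n\<^sup>2) * real N" using n by simp
    finally have "(real (card E) * real N) * real N \<le> (C' * real k powr \<epsilon> * real N ^ n\<^sup>2) * real N"
      by (simp add: power2_eq_square mult_ac)
    then have "real (card E) * real N \<le> C' * real k powr \<epsilon> * real N ^ n\<^sup>2" by (simp add: N_def)
    moreover have "real (card E) * real k \<le> real (card E) * real N"
      by (intro mult_left_mono) (auto simp: N_def)
    ultimately show ?thesis by (simp add: E_def card_bounded_int_mats N_def)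
  qed
  show ?thesis
  \<comment> \<open>\<open>C'\<close> may be 0; adding 1 makes the constant strictly
    positive.\<close>
  proof (intro exI[of _ "C' + 1"] conjI allI impI)
    show "C' + 1 > 0" using C'0 by simp
    fix k :: nat assume "k \<ge> 1"
    have "C' * real k powr \<epsilon> * real (card (bounded_int_mats n k)) \<le> (C' + 1) * real k powr \<epsilon> * real (card (bounded_int_mats n k))"
      by (intro mult_right_mono) auto
    with main[OF \<open>k \<ge> 1\<close>] show "real (card {A \<in> bounded_int_mats n k. has_int_eigenvalue A}) * real k
      \<le> (C' + 1) * real k powr \<epsilon> * real (card (bounded_int_mats n k))" by linarith
  qed
qed

theorem theorem1:
  fixes n :: nat and \<epsilon> :: real
  assumes "n \<ge> 2" and "\<epsilon> > 0"
  shows "\<exists>C > 0. \<forall>k \<ge> 1.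
    measure_pmf.prob (pmf_of_set (bounded_int_mats n k)) {A. has_int_eigenvalue A}
      \<le> C / real k powr (1 - \<epsilon>) \<and>
    measure_pmf.prob (pmf_of_set (bounded_int_mats n k)) {A. diagonalizable_over_rat A}
      \<le> C / real k powr (1 - \<epsilon>)"
proof -
  obtain C where C: "C > 0" "\<And>k. k \<ge> 1 \<Longrightarrow>
      real (card {A \<in> bounded_int_mats n k. has_int_eigenvalue A}) * real k
      \<le> C * real k powr \<epsilon> * real (card (bounded_int_mats n k))"
    using card_has_int_eigenvalue_le[OF assms] by blast
  show ?thesis
  proof (intro exI[of _ C] conjI allI impI)
    fix k :: nat assume k: "k \<ge> 1"
    let ?M = "bounded_int_mats n k"
    have prob: "measure_pmf.prob (pmf_of_set ?M) X = real (card (?M \<inter> X)) / real (card ?M)" for X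
      by (rule measure_pmf_of_set[OF bounded_int_mats_nonempty finite_bounded_int_mats])
    have pos: "real (card ?M) > 0"
      using bounded_int_mats_nonempty finite_bounded_int_mats by (simp add: card_gt_0_iff)
    have "real (card (?M \<inter> {A. has_int_eigenvalue A})) * real k \<le> C * real k powr \<epsilon> * real (card ?M)"
      using C(2)[OF k] by (simp add: Int_def)
    then have "real (card (?M \<inter> {A. has_int_eigenvalue A})) / real (card ?M) \<le> C * real k powr \<epsilon> / real k"
      using k pos by (simp add: field_simps)
    also have "\<dots> = C / real k powr (1 - \<epsilon>)" using k by (simp add: powr_diff)
    finally show eig: "measure_pmf.prob (pmf_of_set ?M) {A. has_int_eigenvalue A} \<le> C / real k powr (1 - \<epsilon>)"
      by (simp add: prob)
    \<comment> \<open>Inclusion of events lets the same constant serve both bounds.\<close>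
    have "?M \<inter> {A. diagonalizable_over_rat A} \<subseteq> ?M \<inter> {A. has_int_eigenvalue A}"
      using has_int_eigenvalue_if_diagonalizable_over_rat[of _ n] assms(1)
      by (auto simp: bounded_int_mats_def)
    then have "card (?M \<inter> {A. diagonalizable_over_rat A}) \<le> card (?M \<inter> {A. has_int_eigenvalue A})"
      using finite_bounded_int_mats by (intro card_mono) auto
    then have "measure_pmf.prob (pmf_of_set ?M) {A. diagonalizable_over_rat A}
        \<le> measure_pmf.prob (pmf_of_set ?M) {A. has_int_eigenvalue A}"
      unfolding prob using pos by (intro divide_right_mono) auto
    with eig show "measure_pmf.prob (pmf_of_set ?M) {A. diagonalizable_over_rat A} \<le> C / real k powr (1 - \<epsilon>)"
      by linarith
  qed (rule C(1))
qed

end
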